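(* Consider the Bayesian linear model $Y^n=X\beta+w$, $w\sim\mathcal N(0,\sigma^2I_n)$, with $X\in\mathbb R^{n\times d}$, in the high-dimensional regime $d\gg n$, with the spike-and-slab prior of the context on $\theta=(\beta,\sigma,z)$. Let the true parameter be $(\beta^\ast,\sigma^\ast)$, where $\beta^\ast$ has $s\ll n$ nonzero coefficients, and let $z^\ast$ be the indicator vector associated with $\beta^\ast$. Fix $\alpha\in(0,1)$ and let $\widehat q_\theta$ be the block mean-field $\alpha$-VB solution. Suppose $p_{\beta\mid z^\ast}$ is continuous and thick at $\beta^\ast_{z^\ast}$ (i.e. $p_{\beta\mid z^\ast}(\beta^\ast_{z^\ast})>0$), and $p_\sigma$ is continuous and thick at $\sigma^\ast$ (i.e. $p_\sigma(\sigma^\ast)>0$). If $s\log d/n\to0$ as $n\to\infty$, then it holds with probability tending to one as $n\to\infty$ that $$\bigg\{\int h^2\big[p(\cdot\mid\theta)\,\|\,p(\cdot\mid\theta^\ast)\big]\,\widehat q_\theta(\theta)\,d\theta\bigg\}^{1/2}\ \lesssim\ \sqrt{\frac{s}{n\,\min\{\alpha,1-\alpha\}}\,\log(d\,n)},$$ where $h^2[p(\cdot\mid\theta)\,\|\,p(\cdot\mid\theta^\ast)]$ denotes the per-observation averaged squared Hellinger distance $\frac1n\sum_{i=1}^nh^2[p_i(\cdot\mid\theta)\,\|\,p_i(\cdot\mid\theta^\ast)]$, $p_i(\cdot\mid\theta)$ being the $\mathcal N(x_i^T\beta,\sigma^2)$ density of the $i$th observation and $x_i^T$ the $i$th row of 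$X$.
   Context: Prior. For $z=(z_1,\dots,z_d)\in\{0,1\}^d$, $z_j=I(\beta_j\ne0)$ indicates whether the $j$th covariate is included, and $\beta_z=(\beta_j:z_j=1)$. The prior is: $z_j\overset{iid}{\sim}\frac1d\delta_1+(1-\frac1d)\delta_0$, $j=1,\dots,d$; $\beta_z\mid z\sim p_{\beta\mid z}$ (with the remaining coordinates of $\beta$ equal to $0$); and, independently, $\sigma\sim p_\sigma$. The resulting prior on $\theta=(\beta,\sigma,z)$ is denoted $p_\theta$, and $\theta^\ast=(\beta^\ast,\sigma^\ast,z^\ast)$. Variational approximation. $z$ is treated as part of the parameter, and there are no other latent variables. The block mean-field family consists of all distributions of the form $q(\beta,\sigma,z)=q_\sigma(\sigma)\prod_{j=1}^dq_{z_j,\beta_j}(z_j,\beta_j)$. The block mean-field $\alpha$-VB solution $\widehat q_\theta$ is a (data-dependent) minimizer, assumed to exist, over this family of $q_\theta\mapsto-\int\log\frac{p(Y^n\mid\theta)}{p(Y^n\mid\theta^\ast)}\,q_\theta(d\theta)+\alpha^{-1}D(q_\theta\,\|\,p_\theta)$, where $p(Y^n\mid\theta)$ is the density of $\mathcal N(X\beta,\sigma^2I_n)$ at $Y^n$ and $D$ is the KL divergence. Probability is under the law of $Y^n$ at the true parameter. $h(p\,\|\,q)=\big(\int(p^{1/2}-q^{1/2})^2\,d\mu\big)^{1/2}$. The quantities $d$ and $s$ may vary with $n$. $\lesssim$ denotes inequality up to a positive multiplicative constant not depending on $n,d,s$ or $\alpha$.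
   Formalization: Added, as the claim fails otherwise: s ≥ 1 for large n; active columns of X have entries at most (dn)^κ; p_{β|z*} is at least (dn)^(-κs) within (dn)^(-κ) of β*_{z*}, for a fixed κ > 0. The constant may depend on κ, p_σ and σ*. *)

theory Defs
  imports "HOL-Probability.Probability"
begin

text \<open>
  A parameter \<open>\<theta> = (\<beta>, \<sigma>, z)\<close> is encoded as \<open>(\<sigma>, \<omega>)\<close> with \<open>\<omega> j = (z\<^sub>j, \<beta>\<^sub>j)\<close> for \<open>j < d\<close>, so that the
  blocks of the variational family are the coordinates of a product space.
\<close>

type_synonym param = "real \<times> (nat \<Rightarrow> bool \<times> real)"

definition coef_space :: "nat \<Rightarrow> (nat \<Rightarrow> bool \<times> real) measure" where
  "coef_space d = PiM {..<d} (\<lambda>_. count_space UNIV \<Otimes>\<^sub>M borel)"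

definition active_set :: "nat \<Rightarrow> (nat \<Rightarrow> real) \<Rightarrow> nat set" where
  "active_set d b = {j. j < d \<and> b j \<noteq> 0}"

definition param_of :: "nat \<Rightarrow> (nat \<Rightarrow> real) \<Rightarrow> real \<Rightarrow> param" where
  "param_of d b \<sigma> = (\<sigma>, \<lambda>j\<in>{..<d}. (b j \<noteq> 0, b j))"

definition obs_density :: "(nat \<Rightarrow> nat \<Rightarrow> real) \<Rightarrow> nat \<Rightarrow> param \<Rightarrow> nat \<Rightarrow> real \<Rightarrow> real" where
  "obs_density X d \<theta> i = normal_density (\<Sum>j<d. X i j * snd (snd \<theta> j)) (fst \<theta>)"

definition likelihood :: "(nat \<Rightarrow> nat \<Rightarrow> real) \<Rightarrow> nat \<Rightarrow> nat \<Rightarrow> param \<Rightarrow> (nat \<Rightarrow> real) \<Rightarrow> real" where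
  "likelihood X n d \<theta> Y = (\<Prod>i<n. obs_density X d \<theta> i (Y i))"

definition data_law :: "(nat \<Rightarrow> nat \<Rightarrow> real) \<Rightarrow> nat \<Rightarrow> nat \<Rightarrow> param \<Rightarrow> (nat \<Rightarrow> real) measure" where
  "data_law X n d \<theta> = PiM {..<n} (\<lambda>i. density lborel (\<lambda>y. ennreal (obs_density X d \<theta> i y)))"

text \<open>
  The inclusion vector \<open>z\<close> is identified with \<open>S = {j. j < d \<and> z\<^sub>j}\<close>, and \<open>slab S\<close> is the density of
  \<open>\<beta>\<^sub>z\<close> given \<open>z\<close> on \<open>\<real>\<^bsup>S\<^esup>\<close>, whose points are the functions in \<open>S \<rightarrow>\<^sub>E UNIV\<close>.
\<close>

definition slab_densities :: "nat \<Rightarrow> (nat set \<Rightarrow> (nat \<Rightarrow> real) \<Rightarrow> real) \<Rightarrow> bool" where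
  "slab_densities d slab \<longleftrightarrow> (\<forall>S\<subseteq>{..<d}.
     slab S \<in> borel_measurable (PiM S (\<lambda>_. lborel)) \<and>
     (\<forall>b\<in>S \<rightarrow>\<^sub>E UNIV. 0 \<le> slab S b) \<and>
     (\<integral>\<^sup>+b. ennreal (slab S b) \<partial>PiM S (\<lambda>_. lborel)) = 1)"

definition slab_law ::
    "nat \<Rightarrow> (nat set \<Rightarrow> (nat \<Rightarrow> real) \<Rightarrow> real) \<Rightarrow> nat set \<Rightarrow> (nat \<Rightarrow> bool \<times> real) measure" where
  "slab_law d slab S =
     distr (density (PiM S (\<lambda>_. lborel)) (\<lambda>b. ennreal (slab S b))) (coef_space d)
       (\<lambda>b. \<lambda>j\<in>{..<d}. if j \<in> S then (True, b j) else (False, 0))"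

definition prior ::
    "nat \<Rightarrow> (real \<Rightarrow> real) \<Rightarrow> (nat set \<Rightarrow> (nat \<Rightarrow> real) \<Rightarrow> real) \<Rightarrow> param measure" where
  "prior d psig slab =
     density lborel (\<lambda>\<sigma>. ennreal (psig \<sigma>)) \<Otimes>\<^sub>M
     (measure_pmf (Pi_pmf {..<d} False (\<lambda>_. bernoulli_pmf (1 / real d)))
        \<bind> (\<lambda>z. slab_law d slab {j. j < d \<and> z j}))"

text \<open>
  \<open>D(q \<parallel> p)\<close> with values in the extended reals. \<^const>\<open>KL_divergence\<close> takes the reference measure \<open>p\<close> first
  and is only meaningful if \<open>q\<close> has a density with respect to \<open>p\<close> whose logarithm is \<open>q\<close>-integrable;
  otherwise the divergence is infinite.
\<close>

definition KL :: "'a measure \<Rightarrow> 'a measure \<Rightarrow> ereal" where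
  "KL q p =
     (if absolutely_continuous p q \<and> integrable q (entropy_density (exp 1) p q)
      then ereal (KL_divergence (exp 1) p q) else \<infinity>)"

definition block_mean_field :: "nat \<Rightarrow> param measure \<Rightarrow> bool" where
  "block_mean_field d q \<longleftrightarrow> (\<exists>qs qc.
     prob_space qs \<and> sets qs = sets borel \<and>
     (\<forall>j<d. prob_space (qc j) \<and> sets (qc j) = sets (count_space UNIV \<Otimes>\<^sub>M borel)) \<and>
     q = qs \<Otimes>\<^sub>M PiM {..<d} qc)"

text \<open>
  The integral of minus the log-likelihood ratio is written as the difference of the integrals of its
  positive and negative parts. For almost every \<open>Y\<close> the subtracted one is finite whenever the
  divergence is; if the divergence is infinite, so is the objective (\<open>\<infinity> - \<infinity> = \<infinity>\<close> in \<^typ>\<open>ereal\<close>).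
\<close>

definition vb_objective ::
    "real \<Rightarrow> (param \<Rightarrow> real) \<Rightarrow> param \<Rightarrow> param measure \<Rightarrow> param measure \<Rightarrow> ereal" where
  "vb_objective \<alpha> lik \<theta>0 p q =
     (let r = (\<lambda>\<theta>. ln (lik \<theta> / lik \<theta>0)) in
        enn2ereal (\<integral>\<^sup>+\<theta>. ennreal (- r \<theta>) \<partial>q) - enn2ereal (\<integral>\<^sup>+\<theta>. ennreal (r \<theta>) \<partial>q)
        + KL q p / ereal \<alpha>)"

definition vb_solution ::
    "nat \<Rightarrow> real \<Rightarrow> (param \<Rightarrow> real) \<Rightarrow> param \<Rightarrow> param measure \<Rightarrow> param measure \<Rightarrow> bool" where
  "vb_solution d \<alpha> lik \<theta>0 p q \<longleftrightarrow>
     block_mean_field d q \<and>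
     (\<forall>q'. block_mean_field d q' \<longrightarrow> vb_objective \<alpha> lik \<theta>0 p q \<le> vb_objective \<alpha> lik \<theta>0 p q')"

definition hellinger :: "(real \<Rightarrow> real) \<Rightarrow> (real \<Rightarrow> real) \<Rightarrow> real" where
  "hellinger f g = sqrt (\<integral>y. (sqrt (f y) - sqrt (g y))\<^sup>2 \<partial>lborel)"

definition avg_hellinger_sq ::
    "(nat \<Rightarrow> nat \<Rightarrow> real) \<Rightarrow> nat \<Rightarrow> nat \<Rightarrow> param \<Rightarrow> param \<Rightarrow> real" where
  "avg_hellinger_sq X n d \<theta> \<theta>' =
     (\<Sum>i<n. (hellinger (obs_density X d \<theta> i) (obs_density X d \<theta>' i))\<^sup>2) / real n"

text \<open>
  No measurability of the dependence of the minimizer on the data is assumed, so the event in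
  question is required to contain measurable events of probability tending to one.
\<close>

definition with_prob_tending_to_one ::
    "(nat \<Rightarrow> 'a measure) \<Rightarrow> (nat \<Rightarrow> 'a \<Rightarrow> bool) \<Rightarrow> bool" where
  "with_prob_tending_to_one M P \<longleftrightarrow> (\<exists>A. (\<forall>n. A n \<in> sets (M n)) \<and> (\<forall>n. \<forall>Y\<in>A n. P n Y) \<and>
     (\<lambda>n. measure (M n) (A n)) \<longlonglongrightarrow> 1)"

definition slab_continuous_thick ::
    "nat set \<Rightarrow> (nat set \<Rightarrow> (nat \<Rightarrow> real) \<Rightarrow> real) \<Rightarrow> (nat \<Rightarrow> real) \<Rightarrow> bool" where
  "slab_continuous_thick S slab b \<longleftrightarrow>
     (slab S \<longlongrightarrow> slab S (restrict b S)) (at (restrict b S) within S \<rightarrow>\<^sub>E UNIV) \<and>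
     0 < slab S (restrict b S)"

text \<open>
  Continuity and thickness of the slab are statements about one density. Since \<open>d\<close>, \<open>s\<close>, the slab, the
  coefficients and the design vary with \<open>n\<close>, they must not degenerate faster than polynomially in \<open>d n\<close>:
  an active column of size \<open>exp (n\<^sup>2)\<close>, or a slab of height \<open>exp (- n\<^sup>2)\<close> around the true coefficients,
  can make the prior mass near the truth negligible against that of a wrong model, and the rate then
  fails. For a slab and true coefficients not depending on \<open>n\<close>, the second clause follows, for all large
  \<open>n\<close> and every \<open>\<kappa> > 0\<close>, from continuity and thickness. The first clause only concerns active columns;
  with \<open>\<kappa> = 1\<close> it holds for all large \<open>n\<close> for bounded entries or columns of norm at most \<open>sqrt n\<close>.
\<close>

definition poly_regular ::
    "real \<Rightarrow> nat \<Rightarrow> nat \<Rightarrow> (nat \<Rightarrow> nat \<Rightarrow> real) \<Rightarrow> nat set \<Rightarrow>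
     (nat set \<Rightarrow> (nat \<Rightarrow> real) \<Rightarrow> real) \<Rightarrow> (nat \<Rightarrow> real) \<Rightarrow> bool" where
  "poly_regular \<kappa> n d X S slab b \<longleftrightarrow>
     (\<forall>i<n. \<forall>j\<in>S. \<bar>X i j\<bar> \<le> (real d * real n) powr \<kappa>) \<and>
     (\<forall>x\<in>S \<rightarrow>\<^sub>E UNIV. L2_set (\<lambda>j. x j - b j) S \<le> (real d * real n) powr (- \<kappa>) \<longrightarrow>
        (real d * real n) powr (- \<kappa> * real (card S)) \<le> slab S x)"

end

theory Submission
  imports Defs
begin

text \<open>
  Let \<open>m = min \<alpha> (1 - \<alpha>)\<close>. For each observation the expectation of \<open>(p\<^sub>i / p\<^sub>i\<^sup>*)\<^sup>\<alpha>\<close> under the truth is at most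
  \<open>exp (- m h\<^sup>2)\<close>, by weighted AM-GM, so \<open>exp (\<alpha> log (p / p\<^sup>*) + m n h\<^sup>2)\<close> has expectation at most one for each
  \<open>\<theta>\<close>. By Fubini and Markov its prior integral is at most \<open>d n\<close> with probability at least \<open>1 - 1 / (d n)\<close>;
  on that event Donsker--Varadhan bounds \<open>m n \<integral> h\<^sup>2 dq\<close> by \<open>\<alpha>\<close> times the variational objective of \<open>q\<close>
  plus \<open>log (d n)\<close>, for every \<open>q\<close> of finite objective. The minimizer is then compared with the product of uniform
  distributions on \<open>[\<sigma>\<^sup>*, \<sigma>\<^sup>* + 1/n]\<close> and on intervals of radius \<open>(d n)\<^sup>-\<^sup>\<kappa>\<^sup>-\<^sup>1\<close> around the active coefficients, the
  inactive ones being zero: it is dominated by \<open>exp (O (s log (d n)))\<close> times the prior, and on its support the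
  log-likelihood loss is \<open>O (1 + \<Sum>\<^sub>i w\<^sub>i\<^sup>2 / n)\<close>.
\<close>

section \<open>Relative entropy\<close>

text \<open>A slab density on R^S need not factorise, so the prior restricted to a neighbourhood of
  the truth is in general not block mean-field. A product of uniforms is, and setwise domination by
  \<open>K\<close> times the prior already gives divergence at most \<open>ln K\<close>; the slab
  thus only has to be bounded below on a small box. The \<sigma>-interval lies to the right of the
  truth, so that variances compare monotonically. The extra power in the radius pays for summing
  over at most \<open>d\<close> active columns: each linear predictor moves by at most 1/n, the loss
  is bounded pointwise on the support, and Markov's inequality suffices for the probability.

  The favourable event does not involve q, so it serves the data-dependent minimizer without any
  measurability of it. The obstacle is integrability: an upper bound on the objective does not
  exclude an infinite positive part of the log-likelihood ratio. The variational inequality is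
  therefore stated through an integrable majorant, which does exclude it. Multiplying the objective
  by \<alpha> cancels the factor 1/\<alpha> of the divergence, so the constant is free of
  \<alpha>.\<close>

lemma emeasure_dominated_RN_deriv_le:
  assumes "prob_space p" "prob_space q" and sets: "sets q = sets p"
    and dom: "\<And>A. A \<in> sets p \<Longrightarrow> emeasure q A \<le> ennreal K * emeasure p A"
  shows "absolutely_continuous p q" "AE x in p. RN_deriv p q x \<le> ennreal K"
proof -
  interpret p: prob_space p by fact
  interpret q: prob_space q by fact
  show ac: "absolutely_continuous p q"
  proof (unfold absolutely_continuous_def, rule subsetI)
    fix A assume "A \<in> null_sets p"
    then have "A \<in> sets p" "emeasure p A = 0" by auto
    with dom[of A] sets show "A \<in> null_sets q" by auto
  qed
  define g where "g = RN_deriv p q"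
  have [measurable]: "g \<in> borel_measurable p" by (simp add: g_def)
  have dens: "density p g = q"
    unfolding g_def by (rule p.density_RN_deriv[OF ac sets])
  \<comment> \<open>The excess of the density over \<open>K\<close>, integrated over the set where
    it is positive, equals q(B) - K p(B), which domination makes zero under truncated subtraction. A
    nonnegative function with zero integral vanishes almost everywhere.\<close>
  define B where "B = {x \<in> space p. ennreal K < g x}"
  have B[measurable]: "B \<in> sets p" by (simp add: B_def)
  have "(\<integral>\<^sup>+x. (g x - ennreal K) * indicator B x \<partial>p)
      = (\<integral>\<^sup>+x. g x * indicator B x - ennreal K * indicator B x \<partial>p)"
    by (intro nn_integral_cong) (simp split: split_indicator)
  also have "\<dots> = (\<integral>\<^sup>+x. g x * indicator B x \<partial>p) - (\<integral>\<^sup>+x. ennreal K * indicator B x \<partial>p)"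
  proof (rule nn_integral_diff)
    have "(\<integral>\<^sup>+x. ennreal K * indicator B x \<partial>p) = ennreal K * emeasure p B"
      by (simp add: nn_integral_cmult)
    then show "(\<integral>\<^sup>+x. ennreal K * indicator B x \<partial>p) \<noteq> \<infinity>"
      by (simp add: ennreal_mult_eq_top_iff)
    show "AE x in p. ennreal K * indicator B x \<le> g x * indicator B x"
      by (auto simp: B_def split: split_indicator)
  qed auto
  also have "(\<integral>\<^sup>+x. g x * indicator B x \<partial>p) = emeasure q B"
    using dens by (metis B emeasure_density \<open>g \<in> borel_measurable p\<close>)
  also have "(\<integral>\<^sup>+x. ennreal K * indicator B x \<partial>p) = ennreal K * emeasure p B"
    by (simp add: nn_integral_cmult)
  also have "emeasure q B - ennreal K * emeasure p B = 0"
    by (rule diff_eq_0_ennreal[OF less_top[THEN iffD1, OF q.emeasure_finite] dom[OF B]])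
  finally have "AE x in p. (g x - ennreal K) * indicator B x = 0"
    by (subst (asm) nn_integral_0_iff_AE) auto
  then show "AE x in p. RN_deriv p q x \<le> ennreal K"
    unfolding g_def[symmetric] using AE_space
  proof eventually_elim
    case (elim x)
    show ?case
    proof (rule ccontr)
      assume "\<not> g x \<le> ennreal K"
      then have lt: "ennreal K < g x" by simp
      with elim have "x \<in> B" by (simp add: B_def)
      then have "g x - ennreal K = 0" using elim by simp
      then show False using lt by (simp add: ennreal_minus_eq_0 leD)
    qed
  qed
qed

text \<open>A density bounded by \<open>K\<close> has logarithm at most \<open>ln K\<close>. The
  remaining work is integrability of that logarithm under \<open>q\<close>, since \<open>KL\<close>
  is infinite without it; it reduces to boundedness of g ln g on [0, K].\<close>

lemma KL_le_ln_of_dominated: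
  assumes p: "prob_space p" and q: "prob_space q" and sets: "sets q = sets p"
    and dom: "\<And>A. A \<in> sets p \<Longrightarrow> emeasure q A \<le> ennreal K * emeasure p A"
  shows "KL q p \<le> ereal (ln K)"
proof -
  interpret p: prob_space p by fact
  interpret q: prob_space q by fact
  have ac: "absolutely_continuous p q" and bd: "AE x in p. RN_deriv p q x \<le> ennreal K"
    using emeasure_dominated_RN_deriv_le[OF p q sets] dom by blast+
  \<comment> \<open>Domination applied to the whole space compares the two total masses.\<close>
  have "1 \<le> ennreal K"
    using dom[of "space p"] p.emeasure_space_1 q.emeasure_space_1 sets_eq_imp_space_eq[OF sets] by simp
  then have K: "1 \<le> K" by simp
  define G where "G x = enn2real (RN_deriv p q x)" for x
  have [measurable]: "G \<in> borel_measurable p" by (simp add: G_def[abs_def])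
  have GK: "AE x in p. RN_deriv p q x = ennreal (G x) \<and> 0 \<le> G x \<and> G x \<le> K"
    using bd
  proof eventually_elim
    case (elim x)
    then have "RN_deriv p q x < \<infinity>" by (simp add: le_less_trans)
    moreover have "G x \<le> enn2real (ennreal K)"
      unfolding G_def using elim by (intro enn2real_mono) auto
    ultimately show ?case using K by (simp add: G_def)
  qed
  have dens: "q = density p (\<lambda>x. ennreal (G x))"
  proof -
    have "density p (RN_deriv p q) = density p (\<lambda>x. ennreal (G x))"
      by (rule density_cong) (use GK in auto)
    then show ?thesis using p.density_RN_deriv[OF ac sets] by simp
  qed
  have ed: "entropy_density (exp 1) p q = (\<lambda>x. ln (G x))"
    by (simp add: entropy_density_def G_def fun_eq_iff log_ln)
  \<comment> \<open>The lower bound -1 comes from ln (1/g) \<le> 1/g - 1 multiplied by g; the upper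
    bound K * K is deliberately crude, as only finiteness matters.\<close>
  have bound: "\<bar>g * ln g\<bar> \<le> 1 + K * K" if "0 \<le> g" "g \<le> K" for g :: real
  proof (cases "g = 0")
    case False
    with that have g: "0 < g" by simp
    have "g * ln g \<le> K * K"
    proof (cases "1 \<le> g")
      case True
      have "ln g \<le> g" using ln_le_minus_one[OF g] by simp
      then have "ln g \<le> K" using that by simp
      then show ?thesis using that True by (intro mult_mono) auto
    next
      case False
      then have "g * ln g \<le> 0" using g by (simp add: mult_nonneg_nonpos)
      also have "0 \<le> K * K" by simp
      finally show ?thesis .
    qed
    moreover have "- 1 \<le> g * ln g"
    proof -
      have "ln (1 / g) \<le> 1 / g - 1" using g by (intro ln_le_minus_one) simp
      then have "- ln g \<le> 1 / g - 1" using g by (simp add: ln_div)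
      then have "g * (- ln g) \<le> g * (1 / g - 1)" using g by (intro mult_left_mono) auto
      then show ?thesis using g by (simp add: algebra_simps)
    qed
    ultimately show ?thesis using mult_nonneg_nonneg[of K K] K by linarith
  qed simp
  have int: "integrable q (\<lambda>x. ln (G x))"
    unfolding dens
  proof (subst integrable_real_density)
    show "integrable p (\<lambda>x. G x * ln (G x))"
      by (rule p.integrable_const_bound[of _ "1 + K * K"]) (use GK bound in auto)
  qed (use GK in auto)
  have "(\<integral>x. ln (G x) \<partial>q) \<le> (\<integral>x. ln K \<partial>q)"
  proof (rule integral_mono_AE[OF int])
    show "AE x in q. ln (G x) \<le> ln K"
      unfolding dens by (subst AE_density) (use GK in \<open>auto simp: ln_le_cancel_iff\<close>)
  qed simp
  also have "\<dots> = ln K" by (simp add: q.prob_space)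
  finally show ?thesis
    using ac int unfolding KL_def ed KL_divergence_def by auto
qed

text \<open>With G the density of \<open>q\<close> and W = exp f / (G M), one has f = ln G + ln W +
  ln M and ln W \<le> W - 1, while W has q-integral at most one. Offering the right-hand side as an
  integrable majorant avoids assuming that f is q-integrable; callers derive that
  afterwards.\<close>

lemma Donsker_Varadhan_majorant:
  fixes f :: "'a \<Rightarrow> real"
  assumes p: "prob_space p" and q: "prob_space q" and sets: "sets q = sets p"
    and ac: "absolutely_continuous p q"
    and ent: "integrable q (entropy_density (exp 1) p q)"
    and f[measurable]: "f \<in> borel_measurable p"
    and M: "0 < M" "(\<integral>\<^sup>+x. ennreal (exp (f x)) \<partial>p) \<le> ennreal M"
  shows "\<exists>u. integrable q u \<and> (AE x in q. f x \<le> u x) \<and>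
    (\<integral>x. u x \<partial>q) \<le> KL_divergence (exp 1) p q + ln M"
proof -
  interpret p: prob_space p by fact
  interpret q: prob_space q by fact
  define G where "G x = enn2real (RN_deriv p q x)" for x
  have [measurable]: "G \<in> borel_measurable p" by (simp add: G_def[abs_def])
  note [measurable_cong] = sets
  have G: "AE x in p. RN_deriv p q x = ennreal (G x)"
    using p.RN_deriv_finite[OF q.sigma_finite_measure_axioms ac sets]
    by eventually_elim (simp add: G_def less_top)
  have G0: "0 \<le> G x" for x by (simp add: G_def)
  have dens: "q = density p (\<lambda>x. ennreal (G x))"
  proof -
    have "density p (RN_deriv p q) = density p (\<lambda>x. ennreal (G x))"
      by (rule density_cong) (use G in auto)
    then show ?thesis using p.density_RN_deriv[OF ac sets] by simp
  qed
  have ed: "entropy_density (exp 1) p q = (\<lambda>x. ln (G x))"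
    by (simp add: entropy_density_def G_def fun_eq_iff log_ln)
  \<comment> \<open>Where \<open>G x = 0\<close> division gives \<open>W x = 0\<close>. The bound G
    W \<le> exp f / M survives there, and the set is q-null, so the pointwise identity for ln W is
    only needed where \<open>G x > 0\<close>.\<close>
  define W where "W x = exp (f x) / (G x * M)" for x
  have [measurable]: "W \<in> borel_measurable p" by (simp add: W_def[abs_def])
  have W0: "0 \<le> W x" for x using M G0 by (simp add: W_def)
  have "(\<integral>\<^sup>+x. ennreal (W x) \<partial>q) = (\<integral>\<^sup>+x. ennreal (G x) * ennreal (W x) \<partial>p)"
    by (subst dens, subst nn_integral_density) auto
  also have "\<dots> \<le> (\<integral>\<^sup>+x. ennreal (1 / M) * ennreal (exp (f x)) \<partial>p)"
    using M G0 W0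
    by (intro nn_integral_mono) (auto simp: W_def ennreal_mult[symmetric] intro!: ennreal_leI)
  also have "\<dots> = ennreal (1 / M) * (\<integral>\<^sup>+x. ennreal (exp (f x)) \<partial>p)"
    by (rule nn_integral_cmult) simp
  also have "\<dots> \<le> ennreal (1 / M) * ennreal M"
    by (rule mult_left_mono[OF M(2)]) simp
  also have "\<dots> = 1" using M by (simp add: ennreal_mult[symmetric])
  finally have W1: "(\<integral>\<^sup>+x. ennreal (W x) \<partial>q) \<le> 1" .
  have Wint: "integrable q W"
    by (rule integrableI_nonneg) (use W0 W1 in \<open>auto simp: le_less_trans\<close>)
  have "ennreal (\<integral>x. W x \<partial>q) \<le> 1"
    using nn_integral_eq_integral[OF Wint] W0 W1 by simp
  then have W1': "(\<integral>x. W x \<partial>q) \<le> 1" by simp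
  have ent': "integrable q (\<lambda>x. ln (G x))" using ent by (simp add: ed)
  show ?thesis
  proof (intro exI[of _ "\<lambda>x. ln (G x) + W x - 1 + ln M"] conjI)
    show "integrable q (\<lambda>x. ln (G x) + W x - 1 + ln M)" using ent' Wint by simp
    have "(\<integral>x. ln (G x) + W x - 1 + ln M \<partial>q) = (\<integral>x. ln (G x) \<partial>q) + (\<integral>x. W x \<partial>q) - 1 + ln M"
      using ent' Wint by (simp add: q.prob_space)
    then show "(\<integral>x. ln (G x) + W x - 1 + ln M \<partial>q) \<le> KL_divergence (exp 1) p q + ln M"
      using W1' by (simp add: KL_divergence_def ed)
    have "AE x in q. 0 < G x"
      unfolding dens by (subst AE_density) (auto simp: ennreal_zero_less_divide)
    then show "AE x in q. f x \<le> ln (G x) + W x - 1 + ln M"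
    proof eventually_elim
      case (elim x)
      have Wp: "0 < W x" using elim M by (simp add: W_def)
      have "ln (W x) = f x - (ln (G x) + ln M)"
        using elim M by (simp add: W_def ln_div ln_mult)
      then show ?case using ln_le_minus_one[OF Wp] by simp
    qed
  qed
qed

section \<open>Tilted likelihood ratios\<close>

lemma integrable_sqrt_diff_sq:
  fixes f g :: "real \<Rightarrow> real"
  assumes f: "integrable lborel f" "\<And>y. 0 \<le> f y" and g: "integrable lborel g" "\<And>y. 0 \<le> g y"
  shows "integrable lborel (\<lambda>y. (sqrt (f y) - sqrt (g y))\<^sup>2)"
proof (rule Bochner_Integration.integrable_bound)
  show "integrable lborel (\<lambda>y. f y + g y)" using f g by simp
  show "AE y in lborel. norm ((sqrt (f y) - sqrt (g y))\<^sup>2) \<le> norm (f y + g y)"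
  proof (rule AE_I2)
    fix y
    have "0 \<le> sqrt (f y) * sqrt (g y)" using f(2)[of y] g(2)[of y] by simp
    then have "(sqrt (f y) - sqrt (g y))\<^sup>2 \<le> f y + g y"
      using f(2)[of y] g(2)[of y] by (simp add: power2_diff)
    then show "norm ((sqrt (f y) - sqrt (g y))\<^sup>2) \<le> norm (f y + g y)" by simp
  qed
  have [measurable]: "f \<in> borel_measurable borel" "g \<in> borel_measurable borel" using f g by auto
  show "(\<lambda>y. (sqrt (f y) - sqrt (g y))\<^sup>2) \<in> borel_measurable lborel" by simp
qed

lemma hellinger_sq: "(hellinger f g)\<^sup>2 = (\<integral>y. (sqrt (f y) - sqrt (g y))\<^sup>2 \<partial>lborel)"
  by (simp add: hellinger_def)

lemma hellinger_sq_le_two: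
  fixes f g :: "real \<Rightarrow> real"
  assumes f: "integrable lborel f" "\<And>y. 0 \<le> f y" "(\<integral>y. f y \<partial>lborel) \<le> 1"
    and g: "integrable lborel g" "\<And>y. 0 \<le> g y" "(\<integral>y. g y \<partial>lborel) \<le> 1"
  shows "(hellinger f g)\<^sup>2 \<le> 2"
proof -
  have "(hellinger f g)\<^sup>2 \<le> (\<integral>y. f y + g y \<partial>lborel)"
    unfolding hellinger_sq
  proof (rule integral_mono[OF integrable_sqrt_diff_sq[OF f(1,2) g(1,2)]])
    fix y
    have "0 \<le> sqrt (f y) * sqrt (g y)" using f(2)[of y] g(2)[of y] by simp
    then show "(sqrt (f y) - sqrt (g y))\<^sup>2 \<le> f y + g y"
      using f(2)[of y] g(2)[of y] by (simp add: power2_diff)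
  qed (use f g in simp)
  then show ?thesis using f g by simp
qed

text \<open>
  Writing \<open>f\<^sup>\<alpha> g\<^sup>1\<^sup>-\<^sup>\<alpha>\<close> as a weighted geometric mean of \<open>sqrt (f g)\<close> and \<open>g\<close> (if \<open>\<alpha> \<le> 1/2\<close>) or \<open>f\<close>
  (if \<open>\<alpha> \<ge> 1/2\<close>) makes the weight of the affinity term \<open>2 min \<alpha> (1 - \<alpha>)\<close>.
\<close>

lemma tilted_density_le:
  fixes x y :: real
  assumes "0 < x" "0 < y" "0 < \<alpha>" "\<alpha> < 1"
  shows "y * exp (\<alpha> * ln (x / y)) \<le> \<alpha> * x + (1 - \<alpha>) * y - min \<alpha> (1 - \<alpha>) * (sqrt x - sqrt y)\<^sup>2"
proof -
  define a b where "a = ln x" and "b = ln y"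
  have x: "x = exp a" and y: "y = exp b" using assms by (auto simp: a_def b_def)
  \<comment> \<open>Weighted AM-GM in logarithmic coordinates, that is, convexity of exp.\<close>
  have conv: "exp (t * u + (1 - t) * v) \<le> t * exp u + (1 - t) * exp v"
    if "0 \<le> t" "t \<le> 1" for t u v :: real
    using convex_onD[OF exp_convex, of "1 - t" u v] that by simp
  have s: "sqrt x * sqrt y = exp ((a + b) / 2)"
    using ln_sqrt[of x] ln_sqrt[of y] assms
    by (simp add: a_def b_def exp_add add_divide_distrib exp_ln flip: ln_sqrt)
  have sq: "(sqrt x - sqrt y)\<^sup>2 = x + y - 2 * exp ((a + b) / 2)"
    using assms s by (simp add: power2_diff)
  have lhs: "y * exp (\<alpha> * ln (x / y)) = exp (\<alpha> * a + (1 - \<alpha>) * b)"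
    unfolding x y by (simp add: exp_diff[symmetric] exp_add[symmetric] algebra_simps)
  show ?thesis
  proof (cases "\<alpha> \<le> 1 / 2")
    case True
    have "\<alpha> * a + (1 - \<alpha>) * b = (2 * \<alpha>) * ((a + b) / 2) + (1 - 2 * \<alpha>) * b" by algebra
    then have "exp (\<alpha> * a + (1 - \<alpha>) * b) \<le> (2 * \<alpha>) * exp ((a + b) / 2) + (1 - 2 * \<alpha>) * exp b"
      using conv[of "2 * \<alpha>" "(a + b) / 2" b] True assms by simp
    moreover have "min \<alpha> (1 - \<alpha>) = \<alpha>" using True by simp
    ultimately show ?thesis unfolding lhs sq unfolding x y by (simp add: algebra_simps)
  next
    case False
    have "\<alpha> * a + (1 - \<alpha>) * b = (2 * (1 - \<alpha>)) * ((a + b) / 2) + (1 - 2 * (1 - \<alpha>)) * a" by algebra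
    then have "exp (\<alpha> * a + (1 - \<alpha>) * b) \<le>
        (2 * (1 - \<alpha>)) * exp ((a + b) / 2) + (1 - 2 * (1 - \<alpha>)) * exp a"
      using conv[of "2 * (1 - \<alpha>)" "(a + b) / 2" a] False assms by simp
    moreover have "min \<alpha> (1 - \<alpha>) = 1 - \<alpha>" using False by simp
    ultimately show ?thesis unfolding lhs sq unfolding x y by (simp add: algebra_simps)
  qed
qed

lemma tilted_integral_le:
  fixes f g :: "real \<Rightarrow> real"
  assumes f: "integrable lborel f" "\<And>y. 0 < f y" "(\<integral>y. f y \<partial>lborel) = 1"
    and g: "integrable lborel g" "\<And>y. 0 < g y" "(\<integral>y. g y \<partial>lborel) = 1"
    and \<alpha>: "0 < \<alpha>" "\<alpha> < 1"
  shows "(\<integral>\<^sup>+y. ennreal (exp (\<alpha> * ln (f y / g y))) \<partial>density lborel (\<lambda>y. ennreal (g y)))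
    \<le> ennreal (exp (- min \<alpha> (1 - \<alpha>) * (hellinger f g)\<^sup>2))"
proof -
  let ?m = "min \<alpha> (1 - \<alpha>)"
  have [measurable]: "f \<in> borel_measurable borel" "g \<in> borel_measurable borel" using f g by auto
  \<comment> \<open>The pointwise upper bound integrates exactly: the two densities contribute
    \<alpha> + (1 - \<alpha>) = 1 and the last term gives the Hellinger distance.\<close>
  define w where "w y = \<alpha> * f y + (1 - \<alpha>) * g y - ?m * (sqrt (f y) - sqrt (g y))\<^sup>2" for y
  have le: "g y * exp (\<alpha> * ln (f y / g y)) \<le> w y" for y
    unfolding w_def by (rule tilted_density_le[OF f(2) g(2) \<alpha>])
  have w0: "0 \<le> w y" for y
    using le[of y] g(2)[of y] by (meson exp_ge_zero less_imp_le mult_nonneg_nonneg order_trans)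
  have D: "integrable lborel (\<lambda>y. (sqrt (f y) - sqrt (g y))\<^sup>2)"
    by (rule integrable_sqrt_diff_sq) (use f g in \<open>auto intro: less_imp_le\<close>)
  have w: "integrable lborel w" unfolding w_def using f g D by simp
  have "(\<integral>\<^sup>+y. ennreal (exp (\<alpha> * ln (f y / g y))) \<partial>density lborel (\<lambda>y. ennreal (g y)))
      = (\<integral>\<^sup>+y. ennreal (g y * exp (\<alpha> * ln (f y / g y))) \<partial>lborel)"
    using g(2) by (subst nn_integral_density) (auto simp: ennreal_mult less_imp_le)
  also have "\<dots> \<le> (\<integral>\<^sup>+y. ennreal (w y) \<partial>lborel)"
    by (intro nn_integral_mono ennreal_leI le)
  also have "\<dots> = ennreal (\<integral>y. w y \<partial>lborel)"
    using w w0 by (intro nn_integral_eq_integral) auto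
  also have "(\<integral>y. w y \<partial>lborel) = 1 - ?m * (hellinger f g)\<^sup>2"
    unfolding w_def hellinger_sq using f g D by simp
  \<comment> \<open>Passing from 1 - x to exp (-x) makes the bound multiplicative over
    observations.\<close>
  also have "ennreal (1 - ?m * (hellinger f g)\<^sup>2) \<le> ennreal (exp (- ?m * (hellinger f g)\<^sup>2))"
    using exp_ge_add_one_self[of "- ?m * (hellinger f g)\<^sup>2"] by (intro ennreal_leI) simp
  finally show ?thesis .
qed

section \<open>Gaussian observation densities and their likelihood ratios\<close>

lemma obs_density_pos: "fst \<theta> \<noteq> 0 \<Longrightarrow> 0 < obs_density X d \<theta> i y"
  by (simp add: obs_density_def normal_density_def)

lemma obs_density_nonneg [simp]: "0 \<le> obs_density X d \<theta> i y"
  by (simp add: obs_density_def)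

lemma borel_measurable_obs_density [measurable]: "obs_density X d \<theta> i \<in> borel_measurable borel"
  by (simp add: obs_density_def)

text \<open>The scale enters only through its square. The variational \<sigma>-block may charge
  negative reals, and this reduces them to the usual positive-scale facts.\<close>

lemma normal_density_abs: "normal_density \<mu> \<bar>\<sigma>\<bar> = normal_density \<mu> \<sigma>"
  by (simp add: normal_density_def fun_eq_iff)

text \<open>At \<sigma> = 0 division by zero turns the density into the zero function, of integral
  0. Total mass at most one thus holds at every parameter, which is what the unconditional Hellinger
  bound by 2 requires.\<close>

lemma obs_density_integral:
  shows integrable_obs_density: "integrable lborel (obs_density X d \<theta> i)"
    and integral_obs_density: "fst \<theta> \<noteq> 0 \<Longrightarrow> (\<integral>y. obs_density X d \<theta> i y \<partial>lborel) = 1"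
    and integral_obs_density_le: "(\<integral>y. obs_density X d \<theta> i y \<partial>lborel) \<le> 1"
proof -
  have *: "integrable lborel (obs_density X d \<theta> i) \<and> (\<integral>y. obs_density X d \<theta> i y \<partial>lborel) = 1"
    if "fst \<theta> \<noteq> 0"
    using that integrable_normal_density[of "\<bar>fst \<theta>\<bar>"] integral_normal_density[of "\<bar>fst \<theta>\<bar>"]
    by (simp add: obs_density_def normal_density_abs)
  have 0: "obs_density X d \<theta> i = (\<lambda>_. 0)" if "fst \<theta> = 0"
    using that by (simp add: obs_density_def normal_density_def fun_eq_iff)
  show "integrable lborel (obs_density X d \<theta> i)" "(\<integral>y. obs_density X d \<theta> i y \<partial>lborel) \<le> 1"
    using * 0 by (cases "fst \<theta> = 0"; simp)+
  show "fst \<theta> \<noteq> 0 \<Longrightarrow> (\<integral>y. obs_density X d \<theta> i y \<partial>lborel) = 1" using * by blast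
qed

lemma hellinger_obs_density_sq_le_two:
  "(hellinger (obs_density X d \<theta> i) (obs_density X d \<theta>' i))\<^sup>2 \<le> 2"
  by (intro hellinger_sq_le_two integrable_obs_density integral_obs_density_le) auto

lemma avg_hellinger_sq_bounds:
  shows avg_hellinger_sq_nonneg: "0 \<le> avg_hellinger_sq X n d \<theta> \<theta>'"
    and avg_hellinger_sq_le_two: "avg_hellinger_sq X n d \<theta> \<theta>' \<le> 2"
proof -
  show "0 \<le> avg_hellinger_sq X n d \<theta> \<theta>'"
    by (simp add: avg_hellinger_sq_def sum_nonneg)
  have "(\<Sum>i<n. (hellinger (obs_density X d \<theta> i) (obs_density X d \<theta>' i))\<^sup>2) \<le> (\<Sum>i<n. 2)"
    by (rule sum_mono) (rule hellinger_obs_density_sq_le_two)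
  then show "avg_hellinger_sq X n d \<theta> \<theta>' \<le> 2"
    by (cases "n = 0") (auto simp: avg_hellinger_sq_def field_simps)
qed

lemma prob_space_obs_density:
  assumes "fst \<theta> \<noteq> 0"
  shows "prob_space (density lborel (\<lambda>y. ennreal (obs_density X d \<theta> i y)))"
  using prob_space_normal_density[of "\<bar>fst \<theta>\<bar>"] assms
  by (simp add: obs_density_def normal_density_abs)

lemma prob_space_data_law: "fst \<theta> \<noteq> 0 \<Longrightarrow> prob_space (data_law X n d \<theta>)"
  unfolding data_law_def by (intro prob_space_PiM prob_space_obs_density)

lemma ln_likelihood_ratio:
  assumes "fst \<theta> \<noteq> 0" "fst \<theta>' \<noteq> 0"
  shows "ln (likelihood X n d \<theta> Y / likelihood X n d \<theta>' Y)
    = (\<Sum>i<n. ln (obs_density X d \<theta> i (Y i) / obs_density X d \<theta>' i (Y i)))"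
  unfolding likelihood_def prod_dividef[symmetric]
  using assms obs_density_pos[of \<theta>] obs_density_pos[of \<theta>']
  by (intro ln_prod) (simp_all add: less_le)

lemma tilted_likelihood_integral_le:
  assumes \<theta>: "fst \<theta> \<noteq> 0" "fst \<theta>' \<noteq> 0" and \<alpha>: "0 < \<alpha>" "\<alpha> < 1"
  shows "(\<integral>\<^sup>+Y. ennreal (exp (\<alpha> * ln (likelihood X n d \<theta> Y / likelihood X n d \<theta>' Y)
      + min \<alpha> (1 - \<alpha>) * real n * avg_hellinger_sq X n d \<theta> \<theta>')) \<partial>data_law X n d \<theta>') \<le> 1"
proof -
  let ?m = "min \<alpha> (1 - \<alpha>)"
  let ?M = "\<lambda>i. density lborel (\<lambda>y. ennreal (obs_density X d \<theta>' i y))"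
  interpret product_prob_space ?M
    by (simp add: product_prob_space_def product_sigma_finite_def product_prob_space_axioms_def
        prob_space_imp_sigma_finite prob_space_obs_density[OF \<theta>(2)])
  define h where "h i = (hellinger (obs_density X d \<theta> i) (obs_density X d \<theta>' i))\<^sup>2" for i
  have H: "real n * avg_hellinger_sq X n d \<theta> \<theta>' = (\<Sum>i<n. h i)"
    by (cases "n = 0") (simp_all add: avg_hellinger_sq_def h_def)
  define r where "r i y = exp (\<alpha> * ln (obs_density X d \<theta> i y / obs_density X d \<theta>' i y)) * exp (?m * h i)"
    for i y
  have [measurable]: "r i \<in> borel_measurable borel" for i by (simp add: r_def[abs_def])
  have "exp (\<alpha> * ln (likelihood X n d \<theta> Y / likelihood X n d \<theta>' Y)
      + ?m * real n * avg_hellinger_sq X n d \<theta> \<theta>') = (\<Prod>i<n. r i (Y i))" for Y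
    unfolding ln_likelihood_ratio[OF \<theta>] mult.assoc H
    by (simp add: r_def exp_add exp_sum sum_distrib_left prod.distrib)
  then have "(\<integral>\<^sup>+Y. ennreal (exp (\<alpha> * ln (likelihood X n d \<theta> Y / likelihood X n d \<theta>' Y)
      + ?m * real n * avg_hellinger_sq X n d \<theta> \<theta>')) \<partial>data_law X n d \<theta>')
      = (\<integral>\<^sup>+Y. (\<Prod>i<n. ennreal (r i (Y i))) \<partial>PiM {..<n} ?M)"
    by (simp add: data_law_def prod_ennreal r_def)
  also have "\<dots> = (\<Prod>i<n. \<integral>\<^sup>+y. ennreal (r i y) \<partial>?M i)"
    by (rule product_nn_integral_prod) auto
  also have "\<dots> \<le> (\<Prod>i<n. 1)"
  proof (rule prod_mono_ennreal)
    fix i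
    have "(\<integral>\<^sup>+y. ennreal (r i y) \<partial>?M i) = (\<integral>\<^sup>+y. ennreal (exp (?m * h i)) *
        ennreal (exp (\<alpha> * ln (obs_density X d \<theta> i y / obs_density X d \<theta>' i y))) \<partial>?M i)"
      by (simp add: r_def ennreal_mult[symmetric] mult.commute)
    also have "\<dots> = ennreal (exp (?m * h i)) *
        (\<integral>\<^sup>+y. ennreal (exp (\<alpha> * ln (obs_density X d \<theta> i y / obs_density X d \<theta>' i y))) \<partial>?M i)"
      by (rule nn_integral_cmult) simp
    also have "\<dots> \<le> ennreal (exp (?m * h i)) * ennreal (exp (- ?m * h i))"
      unfolding h_def
      by (intro mult_left_mono tilted_integral_le \<alpha> integrable_obs_density integral_obs_density
          obs_density_pos \<theta>) simp
    also have "\<dots> = 1" by (simp add: ennreal_mult[symmetric] exp_add[symmetric])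
    finally show "(\<integral>\<^sup>+y. ennreal (r i y) \<partial>?M i) \<le> 1" .
  qed
  finally show ?thesis by simp
qed

section \<open>The spike-and-slab prior\<close>

lemma sets_slab_law [simp, measurable_cong]: "sets (slab_law d slab S) = sets (coef_space d)"
  by (simp add: slab_law_def)

lemma measurable_slab_embedding [measurable]:
  "(\<lambda>b. \<lambda>j\<in>{..<d}. if j \<in> S then (True, b j) else (False, 0))
    \<in> PiM S (\<lambda>_. lborel) \<rightarrow>\<^sub>M coef_space d"
  unfolding coef_space_def
proof (rule measurable_restrict)
  fix j assume "j \<in> {..<d}"
  show "(\<lambda>b. if j \<in> S then (True, b j) else (False, 0))
      \<in> PiM S (\<lambda>_. lborel) \<rightarrow>\<^sub>M count_space UNIV \<Otimes>\<^sub>M borel"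
  proof (cases "j \<in> S")
    case True
    have "(\<lambda>b. b j) \<in> PiM S (\<lambda>_. lborel) \<rightarrow>\<^sub>M borel"
      using measurable_component_singleton[OF True, of "\<lambda>_. lborel"] by simp
    then show ?thesis using True by simp
  qed simp
qed

lemma slab_densitiesD:
  assumes "slab_densities d slab" "S \<subseteq> {..<d}"
  shows "slab S \<in> borel_measurable (PiM S (\<lambda>_. lborel))"
    "(\<integral>\<^sup>+b. ennreal (slab S b) \<partial>PiM S (\<lambda>_. lborel)) = 1"
  using assms unfolding slab_densities_def by auto

lemma prob_space_slab_law:
  assumes "slab_densities d slab" "S \<subseteq> {..<d}"
  shows "prob_space (slab_law d slab S)"
proof -
  note [measurable] = slab_densitiesD(1)[OF assms]
  have "prob_space (density (PiM S (\<lambda>_. lborel)) (\<lambda>b. ennreal (slab S b)))"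
    using slab_densitiesD(2)[OF assms]
    by (intro prob_spaceI) (simp add: emeasure_density cong: nn_integral_cong)
  then show ?thesis
    unfolding slab_law_def by (rule prob_space.prob_space_distr) simp
qed

definition coef_prior :: "nat \<Rightarrow> (nat set \<Rightarrow> (nat \<Rightarrow> real) \<Rightarrow> real) \<Rightarrow> (nat \<Rightarrow> bool \<times> real) measure" where
  "coef_prior d slab = measure_pmf (Pi_pmf {..<d} False (\<lambda>_. bernoulli_pmf (1 / real d)))
        \<bind> (\<lambda>z. slab_law d slab {j. j < d \<and> z j})"

text \<open>The inclusion vector lives on a discrete space, so every kernel is measurable and only
  the probability property has to be checked.\<close>

lemma slab_law_kernel [measurable]:
  assumes "slab_densities d slab"
  shows "(\<lambda>z. slab_law d slab {j. j < d \<and> z j}) \<in> measure_pmf P \<rightarrow>\<^sub>M prob_algebra (coef_space d)"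
  by (auto simp: space_prob_algebra intro!: prob_space_slab_law[OF assms])

lemma sets_coef_prior [simp, measurable_cong]: "sets (coef_prior d slab) = sets (coef_space d)"
  unfolding coef_prior_def by (intro sets_bind) auto

lemma prob_space_coef_prior:
  assumes "slab_densities d slab"
  shows "prob_space (coef_prior d slab)"
  unfolding coef_prior_def
  by (rule prob_space_bind'[OF _ slab_law_kernel[OF assms]])
    (simp add: space_prob_algebra prob_space_measure_pmf)

text \<open>A mixture dominates each component times its weight; the factor is the prior probability
  that the inclusion vector selects exactly \<open>S\<close>. The integral is bounded below by its
  contribution from that one atom.\<close>

lemma slab_law_le_coef_prior:
  assumes "slab_densities d slab" "S \<subseteq> {..<d}" "1 \<le> d" "A \<in> sets (coef_space d)"
  shows "ennreal ((1 / real d) ^ card S * (1 - 1 / real d) ^ (d - card S)) * emeasure (slab_law d slab S) A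
    \<le> emeasure (coef_prior d slab) A"
proof -
  let ?P = "Pi_pmf {..<d} False (\<lambda>_. bernoulli_pmf (1 / real d))"
  let ?z = "\<lambda>j. j \<in> S"
  have fin: "finite S" using assms(2) finite_subset by blast
  have "pmf ?P ?z = (\<Prod>j<d. pmf (bernoulli_pmf (1 / real d)) (j \<in> S))"
    using assms by (intro pmf_Pi') auto
  also have "\<dots> = (\<Prod>j<d. if j \<in> S then 1 / real d else 1 - 1 / real d)"
    using assms by (intro prod.cong) auto
  also have "\<dots> = (1 / real d) ^ card S * (1 - 1 / real d) ^ (d - card S)"
  proof -
    have "{..<d} \<inter> {j. j \<in> S} = S" "{..<d} \<inter> - {j. j \<in> S} = {..<d} - S" using assms by auto
    then show ?thesis using fin assms
      by (subst prod.If_cases) (auto simp: card_Diff_subset)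
  qed
  finally have pmf: "pmf ?P ?z = (1 / real d) ^ card S * (1 - 1 / real d) ^ (d - card S)" .
  have S: "{j. j < d \<and> j \<in> S} = S" using assms by auto
  have "emeasure (coef_prior d slab) A
      = (\<integral>\<^sup>+z. emeasure (slab_law d slab {j. j < d \<and> z j}) A \<partial>measure_pmf ?P)"
    unfolding coef_prior_def using assms
    by (intro emeasure_bind[where N = "coef_space d"] measurable_prob_algebraD slab_law_kernel) auto
  also have "\<dots> \<ge> (\<integral>\<^sup>+z. emeasure (slab_law d slab S) A * indicator {?z} z \<partial>measure_pmf ?P)"
    using S by (intro nn_integral_mono) (auto split: split_indicator)
  finally have "emeasure (slab_law d slab S) A * emeasure (measure_pmf ?P) {?z}
      \<le> emeasure (coef_prior d slab) A"
    by (simp add: nn_integral_cmult)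
  then show ?thesis by (simp add: emeasure_pmf_single pmf mult.commute)
qed

lemma prior_eq: "prior d psig slab = density lborel (\<lambda>\<sigma>. ennreal (psig \<sigma>)) \<Otimes>\<^sub>M coef_prior d slab"
  by (simp add: prior_def coef_prior_def)

section \<open>Measurability in the parameter, and null sets of the prior\<close>

abbreviation param_space :: "nat \<Rightarrow> param measure" where
  "param_space d \<equiv> borel \<Otimes>\<^sub>M coef_space d"

lemma sets_prior: "sets (prior d psig slab) = sets (param_space d)"
  unfolding prior_eq by (intro sets_pair_measure_cong) auto

lemma measurable_coef [measurable]:
  assumes "j < d"
  shows "(\<lambda>\<theta>. snd (snd \<theta> j)) \<in> borel_measurable (param_space d)"
proof -
  have "(\<lambda>\<omega>. \<omega> j) \<in> coef_space d \<rightarrow>\<^sub>M count_space UNIV \<Otimes>\<^sub>M borel"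
    unfolding coef_space_def using assms by (intro measurable_component_singleton) auto
  then show ?thesis by measurable
qed

lemma measurable_linear_predictor [measurable]:
  "(\<lambda>\<theta>. \<Sum>j<d. X i j * snd (snd \<theta> j)) \<in> borel_measurable (param_space d)"
  by (intro borel_measurable_sum borel_measurable_times measurable_coef) auto

text \<open>Parameter and observation are both left as measurable functions on a common space, so
  that joint measurability in (Y, \<theta>), needed for Fubini, follows by instantiation.\<close>

lemma measurable_obs_density2 [measurable (raw)]:
  assumes [measurable]: "T \<in> M \<rightarrow>\<^sub>M param_space d" "g \<in> borel_measurable M"
  shows "(\<lambda>x. obs_density X d (T x) i (g x)) \<in> borel_measurable M"
proof -
  have [measurable]: "(\<lambda>x. \<Sum>j<d. X i j * snd (snd (T x) j)) \<in> borel_measurable M"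
    by (rule measurable_compose[OF assms(1) measurable_linear_predictor])
  show ?thesis unfolding obs_density_def normal_density_def by measurable
qed

lemma sets_data_law: "sets (data_law X n d \<theta>) = sets (PiM {..<n} (\<lambda>_. borel))"
  unfolding data_law_def by (intro sets_PiM_cong) auto

lemma measurable_likelihood [measurable (raw)]:
  assumes [measurable]: "T \<in> M \<rightarrow>\<^sub>M param_space d" "g \<in> M \<rightarrow>\<^sub>M PiM {..<n} (\<lambda>_. borel)"
  shows "(\<lambda>x. likelihood X n d (T x) (g x)) \<in> borel_measurable M"
  unfolding likelihood_def
  by (intro borel_measurable_prod measurable_obs_density2 assms(1)
      measurable_compose[OF assms(2) measurable_component_singleton])

text \<open>The squared distance is a Lebesgue integral of a jointly measurable function, hence
  measurable in the remaining argument.\<close>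

lemma measurable_hellinger_obs_density [measurable (raw)]:
  assumes [measurable]: "T \<in> M \<rightarrow>\<^sub>M param_space d"
  shows "(\<lambda>x. hellinger (obs_density X d (T x) i) (obs_density X d \<theta>' i)) \<in> borel_measurable M"
proof -
  have [measurable]: "(\<lambda>(x, y). obs_density X d (T x) i y) \<in> borel_measurable (M \<Otimes>\<^sub>M lborel)"
    unfolding case_prod_beta by measurable
  have "(\<lambda>x. \<integral>y. (sqrt (obs_density X d (T x) i y) - sqrt (obs_density X d \<theta>' i y))\<^sup>2 \<partial>lborel)
      \<in> borel_measurable M"
    by (intro lborel.borel_measurable_lebesgue_integral) measurable
  then show ?thesis unfolding hellinger_def by measurable
qed

lemma measurable_avg_hellinger_sq [measurable (raw)]:
  assumes [measurable]: "T \<in> M \<rightarrow>\<^sub>M param_space d"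
  shows "(\<lambda>x. avg_hellinger_sq X n d (T x) \<theta>') \<in> borel_measurable M"
  unfolding avg_hellinger_sq_def by measurable

lemma prob_space_prior:
  assumes "psig \<in> borel_measurable borel" "(\<integral>\<^sup>+\<sigma>. ennreal (psig \<sigma>) \<partial>lborel) = 1"
    and "slab_densities d slab"
  shows "prob_space (prior d psig slab)"
proof -
  interpret c: prob_space "coef_prior d slab" by (rule prob_space_coef_prior[OF assms(3)])
  interpret s: prob_space "density lborel (\<lambda>\<sigma>. ennreal (psig \<sigma>))"
    using assms by (intro prob_spaceI) (simp add: emeasure_density)
  interpret pair_prob_space "density lborel (\<lambda>\<sigma>. ennreal (psig \<sigma>))" "coef_prior d slab" ..
  show ?thesis unfolding prior_eq by (rule prob_space_axioms)
qed

text \<open>The tilted expectation bound is available only for \<sigma> \<noteq> 0. The prior of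
  \<sigma> has a Lebesgue density, so the excluded slice is null and may be dropped after
  Fubini.\<close>

lemma AE_prior_nonzero:
  assumes psig[measurable]: "psig \<in> borel_measurable borel"
    and psig1: "(\<integral>\<^sup>+\<sigma>. ennreal (psig \<sigma>) \<partial>lborel) = 1"
    and slab: "slab_densities d slab"
  shows "AE \<theta> in prior d psig slab. fst \<theta> \<noteq> 0"
proof -
  interpret c: prob_space "coef_prior d slab" by (rule prob_space_coef_prior[OF slab])
  interpret s: prob_space "density lborel (\<lambda>\<sigma>. ennreal (psig \<sigma>))"
    using psig1 by (intro prob_spaceI) (simp add: emeasure_density)
  interpret pair_prob_space "density lborel (\<lambda>\<sigma>. ennreal (psig \<sigma>))" "coef_prior d slab" ..
  have "AE \<sigma> in lborel. \<sigma> \<noteq> (0::real)"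
    by (rule AE_lborel_singleton)
  then have "AE \<sigma> in density lborel (\<lambda>\<sigma>. ennreal (psig \<sigma>)). \<sigma> \<noteq> 0"
    by (subst AE_density) auto
  then have "AE \<sigma> in density lborel (\<lambda>\<sigma>. ennreal (psig \<sigma>)). AE \<omega> in coef_prior d slab. fst (\<sigma>, \<omega>) \<noteq> 0"
    by auto
  then show ?thesis
    unfolding prior_eq
    by (intro AE_pair_measure) measurable
qed

section \<open>The variational objective\<close>

lemma block_mean_field_prob:
  assumes "block_mean_field d q"
  shows "prob_space q" "sets q = sets (param_space d)"
proof -
  obtain qs qc where qs: "prob_space qs" "sets qs = sets borel"
    and qc: "\<And>j. j < d \<Longrightarrow> prob_space (qc j)"
      "\<And>j. j < d \<Longrightarrow> sets (qc j) = sets (count_space UNIV \<Otimes>\<^sub>M borel)"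
    and q: "q = qs \<Otimes>\<^sub>M PiM {..<d} qc"
    using assms unfolding block_mean_field_def by blast
  interpret qs: prob_space qs by fact
  interpret qc: prob_space "PiM {..<d} qc" using qc(1) by (intro prob_space_PiM) auto
  interpret pair_prob_space qs "PiM {..<d} qc" ..
  show "prob_space q" unfolding q by (rule prob_space_axioms)
  show "sets q = sets (param_space d)"
    unfolding q coef_space_def using qc(2) qs(2)
    by (intro sets_pair_measure_cong sets_PiM_cong) auto
qed

text \<open>Write r for the log-likelihood ratio. The objective bound times \<alpha> says that the
  divergence is at most \<alpha> V plus \<alpha> times the q-integral of r; Donsker-Varadhan for
  \<alpha> r + H bounds the integral of that sum by the divergence plus ln M. Adding the two cancels
  both r and the divergence. Finiteness of every term must be settled before the
  cancellation.\<close>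

lemma vb_objective_controls_integral:
  assumes p: "prob_space p" and q: "prob_space q" and sets: "sets q = sets p"
    and \<alpha>: "0 < \<alpha>"
    and obj: "vb_objective \<alpha> lik \<theta>0 p q \<le> ereal V"
    and r: "(\<lambda>\<theta>. ln (lik \<theta> / lik \<theta>0)) \<in> borel_measurable p"
    and H: "H \<in> borel_measurable p" "\<And>\<theta>. 0 \<le> H \<theta>" "\<And>\<theta>. H \<theta> \<le> c"
    and M: "0 < M" "(\<integral>\<^sup>+\<theta>. ennreal (exp (\<alpha> * ln (lik \<theta> / lik \<theta>0) + H \<theta>)) \<partial>p) \<le> ennreal M"
  shows "(\<integral>\<theta>. H \<theta> \<partial>q) \<le> \<alpha> * V + ln M"
proof -
  interpret q: prob_space q by fact
  define r where "r \<theta> = ln (lik \<theta> / lik \<theta>0)" for \<theta>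
  have [measurable]: "r \<in> borel_measurable p" "H \<in> borel_measurable p" using r H by (auto simp: r_def[abs_def])
  note [measurable_cong] = sets
  define a b where "a = (\<integral>\<^sup>+\<theta>. ennreal (- r \<theta>) \<partial>q)" and "b = (\<integral>\<^sup>+\<theta>. ennreal (r \<theta>) \<partial>q)"
  have obj': "enn2ereal a - enn2ereal b + KL q p / ereal \<alpha> \<le> ereal V"
    using obj by (simp add: vb_objective_def r_def a_def b_def)
  have fin: "KL q p \<noteq> \<infinity>"
    using obj' \<alpha> by auto
  then have ac: "absolutely_continuous p q" and ent: "integrable q (entropy_density (exp 1) p q)"
    and KL: "KL q p = ereal (KL_divergence (exp 1) p q)"
    by (auto simp: KL_def split: if_splits)
  \<comment> \<open>An infinite first term would make the extended-real difference, and hence the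
    objective, infinite whatever \<open>b\<close> is.\<close>
  have "a \<noteq> \<infinity>" using obj' by (auto simp: minus_ereal_def)
  then have a: "a < \<infinity>" by (simp add: less_top)
  have "\<exists>u. integrable q u \<and> (AE \<theta> in q. \<alpha> * r \<theta> + H \<theta> \<le> u \<theta>) \<and>
      (\<integral>\<theta>. u \<theta> \<partial>q) \<le> KL_divergence (exp 1) p q + ln M"
    by (rule Donsker_Varadhan_majorant[OF p q sets ac ent _ M(1)])
      (use M(2) in \<open>simp_all add: r_def[symmetric]\<close>)
  then obtain u where u: "integrable q u" "AE \<theta> in q. \<alpha> * r \<theta> + H \<theta> \<le> u \<theta>"
    "(\<integral>\<theta>. u \<theta> \<partial>q) \<le> KL_divergence (exp 1) p q + ln M" by blast
  \<comment> \<open>Since \<open>H\<close> is nonnegative, the majorant gives \<alpha> r \<le> u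
    \<le> |u|. This rules out an infinite positive part of r, that is, an objective of minus
    infinity.\<close>
  have "b \<le> (\<integral>\<^sup>+\<theta>. ennreal (\<bar>u \<theta>\<bar> / \<alpha>) \<partial>q)"
    unfolding b_def
  proof (rule nn_integral_mono_AE)
    show "AE \<theta> in q. ennreal (r \<theta>) \<le> ennreal (\<bar>u \<theta>\<bar> / \<alpha>)"
      using u(2)
    proof eventually_elim
      case (elim \<theta>)
      then have "\<alpha> * r \<theta> \<le> \<bar>u \<theta>\<bar>" using H(2)[of \<theta>] by linarith
      then show ?case using \<alpha> by (intro ennreal_leI) (simp add: pos_le_divide_eq mult.commute)
    qed
  qed
  also have "\<dots> < \<infinity>"
    using u(1) \<alpha> by (subst nn_integral_eq_integral) auto
  finally have b: "b < \<infinity>" .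
  have rint: "integrable q r"
    unfolding real_integrable_def using a b by (auto simp: a_def b_def)
  have ri: "(\<integral>\<theta>. r \<theta> \<partial>q) = enn2real b - enn2real a"
    using real_lebesgue_integral_def[OF rint] by (simp add: a_def b_def)
  have Hint: "integrable q H"
    by (rule q.integrable_const_bound[of _ c]) (use H in auto)
  have "\<alpha> * (\<integral>\<theta>. r \<theta> \<partial>q) + (\<integral>\<theta>. H \<theta> \<partial>q) = (\<integral>\<theta>. \<alpha> * r \<theta> + H \<theta> \<partial>q)"
    using rint Hint by simp
  also have "\<dots> \<le> (\<integral>\<theta>. u \<theta> \<partial>q)"
    by (rule integral_mono_AE) (use rint Hint u in auto)
  finally have 1: "\<alpha> * (\<integral>\<theta>. r \<theta> \<partial>q) + (\<integral>\<theta>. H \<theta> \<partial>q) \<le> KL_divergence (exp 1) p q + ln M"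
    using u(3) by simp
  have "enn2ereal a = ereal (enn2real a)" "enn2ereal b = ereal (enn2real b)"
    using a b by (metis enn2ereal_ennreal enn2real_nonneg ennreal_enn2real infinity_ennreal_def)+
  then have "enn2real a - enn2real b + KL_divergence (exp 1) p q / \<alpha> \<le> V"
    using obj' KL \<alpha> by simp
  then have "\<alpha> * (enn2real a - enn2real b + KL_divergence (exp 1) p q / \<alpha>) \<le> \<alpha> * V"
    using \<alpha> by (intro mult_left_mono) auto
  then have "KL_divergence (exp 1) p q \<le> \<alpha> * V + \<alpha> * (\<integral>\<theta>. r \<theta> \<partial>q)"
    using \<alpha> unfolding ri by (simp add: algebra_simps)
  with 1 show ?thesis by simp
qed

text \<open>The positive part of the log-likelihood ratio enters with a minus sign and can be
  discarded, so an almost-sure bound on the loss replaces any integrability condition.\<close>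

lemma vb_objective_le:
  assumes q: "prob_space q" and \<alpha>: "0 < \<alpha>"
    and r: "AE \<theta> in q. - ln (lik \<theta> / lik \<theta>0) \<le> G" and G: "0 \<le> G"
    and KL: "KL q p \<le> ereal k"
  shows "vb_objective \<alpha> lik \<theta>0 p q \<le> ereal (G + k / \<alpha>)"
proof -
  interpret q: prob_space q by fact
  let ?r = "\<lambda>\<theta>. ln (lik \<theta> / lik \<theta>0)"
  have "(\<integral>\<^sup>+\<theta>. ennreal (- ?r \<theta>) \<partial>q) \<le> (\<integral>\<^sup>+\<theta>. ennreal G \<partial>q)"
    by (rule nn_integral_mono_AE) (use r in \<open>auto elim!: eventually_mono intro: ennreal_leI\<close>)
  also have "\<dots> = ennreal G" by (simp add: q.emeasure_space_1)
  finally have "enn2ereal (\<integral>\<^sup>+\<theta>. ennreal (- ?r \<theta>) \<partial>q) \<le> ereal G"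
    using G by (metis enn2ereal_ennreal less_eq_ennreal.rep_eq)
  then have "enn2ereal (\<integral>\<^sup>+\<theta>. ennreal (- ?r \<theta>) \<partial>q) - enn2ereal (\<integral>\<^sup>+\<theta>. ennreal (?r \<theta>) \<partial>q) \<le> ereal G - 0"
    by (intro ereal_minus_mono) auto
  moreover have "KL q p / ereal \<alpha> \<le> ereal k / ereal \<alpha>"
    using KL \<alpha> by (intro ereal_divide_right_mono) auto
  ultimately have "vb_objective \<alpha> lik \<theta>0 p q \<le> (ereal G - 0) + ereal k / ereal \<alpha>"
    unfolding vb_objective_def Let_def by (intro add_mono)
  then show ?thesis using \<alpha> by simp
qed

section \<open>First-moment bounds under the truth and the high-probability event\<close>

lemma nn_integral_residual_sq:
  assumes \<theta>: "0 < fst \<theta>"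
  shows "(\<integral>\<^sup>+Y. ennreal (\<Sum>i<n. (Y i - (\<Sum>j<d. X i j * snd (snd \<theta> j)))\<^sup>2) \<partial>data_law X n d \<theta>)
    = ennreal (real n * (fst \<theta>)\<^sup>2)"
proof -
  let ?\<mu> = "\<lambda>i. \<Sum>j<d. X i j * snd (snd \<theta> j)"
  let ?M = "\<lambda>i. density lborel (\<lambda>y. ennreal (obs_density X d \<theta> i y))"
  interpret product_prob_space ?M
    using \<theta> by (simp add: product_prob_space_def product_sigma_finite_def product_prob_space_axioms_def
        prob_space_imp_sigma_finite prob_space_obs_density)
  have comp: "(\<integral>\<^sup>+Y. ennreal ((Y i - ?\<mu> i)\<^sup>2) \<partial>PiM {..<n} ?M) = ennreal ((fst \<theta>)\<^sup>2)" if "i < n" for i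
  proof -
    have "(\<integral>\<^sup>+Y. ennreal ((Y i - ?\<mu> i)\<^sup>2) \<partial>PiM {..<n} ?M)
        = (\<integral>\<^sup>+y. ennreal ((y - ?\<mu> i)\<^sup>2) \<partial>distr (PiM {..<n} ?M) (?M i) (\<lambda>Y. Y i))"
      using that by (subst nn_integral_distr) auto
    also have "distr (PiM {..<n} ?M) (?M i) (\<lambda>Y. Y i) = ?M i"
      using that \<theta> by (intro distr_PiM_component prob_space_obs_density) auto
    also have "(\<integral>\<^sup>+y. ennreal ((y - ?\<mu> i)\<^sup>2) \<partial>?M i)
        = (\<integral>\<^sup>+y. ennreal (normal_density (?\<mu> i) (fst \<theta>) y * (y - ?\<mu> i)\<^sup>2) \<partial>lborel)"
      by (subst nn_integral_density) (auto simp: obs_density_def ennreal_mult)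
    also have "\<dots> = ennreal (\<integral>y. normal_density (?\<mu> i) (fst \<theta>) y * (y - ?\<mu> i)\<^sup>2 \<partial>lborel)"
      using integrable_normal_moment[OF \<theta>, of "?\<mu> i" 2] by (intro nn_integral_eq_integral) auto
    also have "(\<integral>y. normal_density (?\<mu> i) (fst \<theta>) y * (y - ?\<mu> i)\<^sup>2 \<partial>lborel) = (fst \<theta>)\<^sup>2"
      using integral_normal_moment_even[OF \<theta>, of "?\<mu> i" 1] \<theta> by (simp add: numeral_2_eq_2)
    finally show ?thesis .
  qed
  have "(\<integral>\<^sup>+Y. ennreal (\<Sum>i<n. (Y i - ?\<mu> i)\<^sup>2) \<partial>data_law X n d \<theta>)
      = (\<integral>\<^sup>+Y. (\<Sum>i<n. ennreal ((Y i - ?\<mu> i)\<^sup>2)) \<partial>PiM {..<n} ?M)"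
    by (simp add: data_law_def sum_ennreal)
  also have "\<dots> = (\<Sum>i<n. \<integral>\<^sup>+Y. ennreal ((Y i - ?\<mu> i)\<^sup>2) \<partial>PiM {..<n} ?M)"
    by (rule nn_integral_sum) measurable
  also have "\<dots> = (\<Sum>i<n. ennreal ((fst \<theta>)\<^sup>2))" by (intro sum.cong refl comp) auto
  also have "\<dots> = ennreal (real n * (fst \<theta>)\<^sup>2)"
    by (simp add: sum_ennreal ennreal_of_nat_eq_real_of_nat ennreal_mult[symmetric])
  finally show ?thesis .
qed

lemma (in prob_space) markov_nn_integral:
  assumes u[measurable]: "u \<in> borel_measurable M" and e: "(\<integral>\<^sup>+x. u x \<partial>M) \<le> ennreal e" and t: "0 < t" "0 \<le> e"
  shows "prob {x \<in> space M. \<not> u x \<le> ennreal t} \<le> e / t"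
proof -
  have "emeasure M {x \<in> space M. \<not> u x \<le> ennreal t} \<le> emeasure M {x \<in> space M. 1 \<le> ennreal (1 / t) * u x}"
  proof (rule emeasure_mono)
    show "{x \<in> space M. \<not> u x \<le> ennreal t} \<subseteq> {x \<in> space M. 1 \<le> ennreal (1 / t) * u x}"
    proof safe
      fix x assume "\<not> u x \<le> ennreal t"
      then have "ennreal (1 / t) * ennreal t \<le> ennreal (1 / t) * u x" by (intro mult_left_mono) auto
      then show "1 \<le> ennreal (1 / t) * u x" using t by (simp add: ennreal_mult[symmetric])
    qed
  qed measurable
  also have "\<dots> \<le> ennreal (1 / t) * (\<integral>\<^sup>+x. u x * indicator (space M) x \<partial>M)"
    by (rule nn_integral_Markov_inequality) auto
  also have "(\<integral>\<^sup>+x. u x * indicator (space M) x \<partial>M) = (\<integral>\<^sup>+x. u x \<partial>M)"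
    by (intro nn_integral_cong) simp
  also have "ennreal (1 / t) * (\<integral>\<^sup>+x. u x \<partial>M) \<le> ennreal (1 / t) * ennreal e"
    by (intro mult_left_mono e) simp
  also have "\<dots> = ennreal (e / t)" using t by (simp add: ennreal_mult[symmetric])
  finally show ?thesis using t by (simp add: emeasure_eq_measure)
qed

text \<open>Three exceptional sets are removed: a null set where \<open>qhat Y\<close> fails to
  minimize, the event that the prior integral of the tilted ratio exceeds \<open>M\<close> (its mean
  is at most one), and the event of large residuals. Outside them the estimate is deterministic, and
  the minimizer's objective is at most that of the fixed competitor \<open>q'\<close>.\<close>

lemma vb_high_probability_bound:
  assumes psig: "psig \<in> borel_measurable borel" "(\<integral>\<^sup>+\<sigma>. ennreal (psig \<sigma>) \<partial>lborel) = 1"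
    and slab: "slab_densities d slab"
    and \<theta>0: "0 < fst \<theta>0" and \<alpha>: "0 < \<alpha>" "\<alpha> < 1"
    and vb: "AE Y in data_law X n d \<theta>0. vb_solution d \<alpha> (\<lambda>\<theta>. likelihood X n d \<theta> Y) \<theta>0
        (prior d psig slab) (qhat Y)"
    and q': "block_mean_field d q'"
    and V: "\<And>Y. (\<Sum>i<n. (Y i - (\<Sum>j<d. X i j * snd (snd \<theta>0 j)))\<^sup>2) \<le> real n * L \<Longrightarrow>
        vb_objective \<alpha> (\<lambda>\<theta>. likelihood X n d \<theta> Y) \<theta>0 (prior d psig slab) q' \<le> ereal V"
    and pos: "0 < M" "0 < L" "1 \<le> n"
  shows "\<exists>A\<in>sets (data_law X n d \<theta>0).
    1 - 1 / M - (fst \<theta>0)\<^sup>2 / L \<le> measure (data_law X n d \<theta>0) A \<and>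
    (\<forall>Y\<in>A. min \<alpha> (1 - \<alpha>) * real n * (\<integral>\<theta>. avg_hellinger_sq X n d \<theta> \<theta>0 \<partial>qhat Y) \<le> \<alpha> * V + ln M)"
proof -
  let ?P = "data_law X n d \<theta>0" and ?p = "prior d psig slab" and ?m = "min \<alpha> (1 - \<alpha>)"
  interpret P: prob_space ?P using \<theta>0 by (intro prob_space_data_law) simp
  interpret p: prob_space ?p by (rule prob_space_prior[OF psig slab])
  interpret pp: pair_sigma_finite ?P ?p ..
  note [measurable_cong] = sets_prior sets_data_law
  define F where "F Y \<theta> = ennreal (exp (\<alpha> * ln (likelihood X n d \<theta> Y / likelihood X n d \<theta>0 Y)
      + ?m * real n * avg_hellinger_sq X n d \<theta> \<theta>0))" for Y \<theta>
  have \<theta>0_meas [measurable]: "(\<lambda>Y. likelihood X n d \<theta>0 Y) \<in> borel_measurable (PiM {..<n} (\<lambda>_. borel))"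
    unfolding likelihood_def by measurable
  have F[measurable]: "case_prod F \<in> borel_measurable (PiM {..<n} (\<lambda>_. borel) \<Otimes>\<^sub>M param_space d)"
    unfolding F_def case_prod_beta by measurable
  have F': "case_prod F \<in> borel_measurable (?P \<Otimes>\<^sub>M ?p)" by measurable
  define I where "I Y = (\<integral>\<^sup>+\<theta>. F Y \<theta> \<partial>?p)" for Y
  have I[measurable]: "I \<in> borel_measurable ?P"
    unfolding I_def by (rule p.borel_measurable_nn_integral[OF F'])
  have "(\<integral>\<^sup>+Y. I Y \<partial>?P) = (\<integral>\<^sup>+\<theta>. (\<integral>\<^sup>+Y. F Y \<theta> \<partial>?P) \<partial>?p)"
    unfolding I_def by (rule pp.Fubini'[symmetric, OF F'])
  also have "\<dots> \<le> (\<integral>\<^sup>+\<theta>. 1 \<partial>?p)"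
    using AE_prior_nonzero[OF psig slab] \<theta>0 \<alpha> unfolding F_def
    by (intro nn_integral_mono_AE) (auto elim!: eventually_mono intro!: tilted_likelihood_integral_le)
  also have "\<dots> = ennreal 1" by (simp add: p.emeasure_space_1)
  finally have I1: "(\<integral>\<^sup>+Y. I Y \<partial>?P) \<le> ennreal 1" .
  define R where "R Y = (\<Sum>i<n. (Y i - (\<Sum>j<d. X i j * snd (snd \<theta>0 j)))\<^sup>2)" for Y
  have R[measurable]: "R \<in> borel_measurable (PiM {..<n} (\<lambda>_. borel))" unfolding R_def by measurable
  have R': "(\<lambda>Y. ennreal (R Y)) \<in> borel_measurable ?P" by measurable
  have R1: "(\<integral>\<^sup>+Y. ennreal (R Y) \<partial>?P) \<le> ennreal (real n * (fst \<theta>0)\<^sup>2)"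
    unfolding R_def by (subst nn_integral_residual_sq[OF \<theta>0]) simp
  \<comment> \<open>The failure set of the minimizer may be non-measurable, so it is enclosed in a
    measurable null set before \<open>A\<close> is formed.\<close>
  obtain N where N: "{Y \<in> space ?P. \<not> vb_solution d \<alpha> (\<lambda>\<theta>. likelihood X n d \<theta> Y) \<theta>0 ?p (qhat Y)} \<subseteq> N"
      "emeasure ?P N = 0" "N \<in> sets ?P"
    using AE_E[OF vb] by blast
  define B1 where "B1 = {Y \<in> space ?P. \<not> I Y \<le> ennreal M}"
  define B2 where "B2 = {Y \<in> space ?P. \<not> ennreal (R Y) \<le> ennreal (real n * L)}"
  have sets: "B1 \<in> sets ?P" "B2 \<in> sets ?P" unfolding B1_def B2_def by measurable
  define A where "A = space ?P - (N \<union> (B1 \<union> B2))"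
  have nL: "0 < real n * L" using pos by simp
  show ?thesis
  proof (intro bexI conjI ballI)
    show "A \<in> sets ?P" using sets N by (auto simp: A_def)
    have "measure ?P (N \<union> (B1 \<union> B2)) \<le> measure ?P N + (measure ?P B1 + measure ?P B2)"
      using sets N by (intro order.trans[OF measure_Un_le] add_left_mono measure_Un_le) auto
    also have "measure ?P N = 0" using N by (simp add: measure_def)
    also have "measure ?P B1 \<le> 1 / M"
      unfolding B1_def using P.markov_nn_integral[OF I I1 pos(1)] by simp
    also have "measure ?P B2 \<le> real n * (fst \<theta>0)\<^sup>2 / (real n * L)"
      unfolding B2_def using P.markov_nn_integral[OF R' R1 nL] by simp
    also have "\<dots> = (fst \<theta>0)\<^sup>2 / L" using pos by simp
    finally have "measure ?P (N \<union> (B1 \<union> B2)) \<le> 1 / M + (fst \<theta>0)\<^sup>2 / L" by simp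
    moreover have "measure ?P A = 1 - measure ?P (N \<union> (B1 \<union> B2))"
      unfolding A_def using sets N by (intro P.prob_compl) auto
    ultimately show "1 - 1 / M - (fst \<theta>0)\<^sup>2 / L \<le> measure ?P A" by simp
    fix Y assume "Y \<in> A"
    then have Y: "Y \<in> space ?P" and vbY: "vb_solution d \<alpha> (\<lambda>\<theta>. likelihood X n d \<theta> Y) \<theta>0 ?p (qhat Y)"
      and IY: "I Y \<le> ennreal M" and RY: "R Y \<le> real n * L"
      using N(1) nL by (auto simp: A_def B1_def B2_def ennreal_le_iff)
    have bmf: "block_mean_field d (qhat Y)" using vbY by (simp add: vb_solution_def)
    have obj: "vb_objective \<alpha> (\<lambda>\<theta>. likelihood X n d \<theta> Y) \<theta>0 ?p (qhat Y) \<le> ereal V"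
      using vbY q' V[of Y] RY unfolding vb_solution_def R_def by (meson order.trans)
    \<comment> \<open>With \<open>Y\<close> frozen at a point of the space, joint measurability
      yields measurability in \<theta> alone.\<close>
    have YM: "Y \<in> space (PiM {..<n} (\<lambda>_. borel))" using Y sets_eq_imp_space_eq[OF sets_data_law] by metis
    have "(\<integral>\<theta>. ?m * real n * avg_hellinger_sq X n d \<theta> \<theta>0 \<partial>qhat Y) \<le> \<alpha> * V + ln M"
    proof (rule vb_objective_controls_integral[OF p.prob_space_axioms block_mean_field_prob(1)[OF bmf] _ \<alpha>(1) obj _ _ _ _ pos(1)])
      show "sets (qhat Y) = sets ?p" using block_mean_field_prob(2)[OF bmf] sets_prior by metis
      show "(\<lambda>\<theta>. ln (likelihood X n d \<theta> Y / likelihood X n d \<theta>0 Y)) \<in> borel_measurable ?p"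
        using YM by measurable
      show "(\<lambda>\<theta>. ?m * real n * avg_hellinger_sq X n d \<theta> \<theta>0) \<in> borel_measurable ?p" by measurable
      show "0 \<le> ?m * real n * avg_hellinger_sq X n d \<theta> \<theta>0" for \<theta>
        using \<alpha> by (simp add: avg_hellinger_sq_nonneg)
      show "?m * real n * avg_hellinger_sq X n d \<theta> \<theta>0 \<le> ?m * real n * 2" for \<theta>
        using \<alpha> by (intro mult_left_mono avg_hellinger_sq_le_two) simp
      show "(\<integral>\<^sup>+\<theta>. ennreal (exp (\<alpha> * ln (likelihood X n d \<theta> Y / likelihood X n d \<theta>0 Y)
          + ?m * real n * avg_hellinger_sq X n d \<theta> \<theta>0)) \<partial>?p) \<le> ennreal M"
        using IY by (simp add: I_def F_def)
    qed
    then show "?m * real n * (\<integral>\<theta>. avg_hellinger_sq X n d \<theta> \<theta>0 \<partial>qhat Y) \<le> \<alpha> * V + ln M"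
      by simp
  qed
qed

section \<open>Product measures dominated by the prior\<close>

text \<open>Setwise domination is the order on measures relative to the rescaled measure, and
  integrals are monotone in that order.\<close>

lemma nn_integral_le_of_dominated:
  assumes sets: "sets \<mu> = sets \<nu>"
    and dom: "\<And>A. A \<in> sets \<nu> \<Longrightarrow> emeasure \<mu> A \<le> K * emeasure \<nu> A"
    and f: "f \<in> borel_measurable \<nu>"
  shows "(\<integral>\<^sup>+x. f x \<partial>\<mu>) \<le> K * (\<integral>\<^sup>+x. f x \<partial>\<nu>)"
proof -
  have "\<mu> \<le> scale_measure K \<nu>"
    using sets dom by (subst le_measure) auto
  then have "(\<integral>\<^sup>+x. f x \<partial>\<mu>) \<le> (\<integral>\<^sup>+x. f x \<partial>scale_measure K \<nu>)"
    using sets by (intro nn_integral_mono_measure) auto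
  then show ?thesis by (simp add: nn_integral_scale_measure[OF f])
qed

text \<open>Domination of the divergence bound is needed on all measurable sets, not just
  rectangles. Slicing \<open>A\<close> allows the second domination under the integral and the first
  one on the integral itself.\<close>

lemma emeasure_pair_le_of_dominated:
  assumes "sigma_finite_measure \<mu>2" "sigma_finite_measure \<nu>2"
    and sets: "sets \<mu>1 = sets \<nu>1" "sets \<mu>2 = sets \<nu>2"
    and dom1: "\<And>A. A \<in> sets \<nu>1 \<Longrightarrow> emeasure \<mu>1 A \<le> K1 * emeasure \<nu>1 A"
    and dom2: "\<And>A. A \<in> sets \<nu>2 \<Longrightarrow> emeasure \<mu>2 A \<le> K2 * emeasure \<nu>2 A"
    and A: "A \<in> sets (\<nu>1 \<Otimes>\<^sub>M \<nu>2)"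
  shows "emeasure (\<mu>1 \<Otimes>\<^sub>M \<mu>2) A \<le> K1 * K2 * emeasure (\<nu>1 \<Otimes>\<^sub>M \<nu>2) A"
proof -
  interpret \<mu>2: sigma_finite_measure \<mu>2 by fact
  interpret \<nu>2: sigma_finite_measure \<nu>2 by fact
  have "sets (\<mu>1 \<Otimes>\<^sub>M \<mu>2) = sets (\<nu>1 \<Otimes>\<^sub>M \<nu>2)" by (intro sets_pair_measure_cong sets)
  then have A': "A \<in> sets (\<mu>1 \<Otimes>\<^sub>M \<mu>2)" using A by simp
  have m: "(\<lambda>x. emeasure \<nu>2 (Pair x -` A)) \<in> borel_measurable \<nu>1"
    using A by (rule \<nu>2.measurable_emeasure_Pair)
  have "emeasure (\<mu>1 \<Otimes>\<^sub>M \<mu>2) A = (\<integral>\<^sup>+x. emeasure \<mu>2 (Pair x -` A) \<partial>\<mu>1)"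
    by (rule \<mu>2.emeasure_pair_measure_alt[OF A'])
  also have "\<dots> \<le> (\<integral>\<^sup>+x. K2 * emeasure \<nu>2 (Pair x -` A) \<partial>\<mu>1)"
    using A by (intro nn_integral_mono dom2 sets_Pair1)
  also have "\<dots> \<le> K1 * (\<integral>\<^sup>+x. K2 * emeasure \<nu>2 (Pair x -` A) \<partial>\<nu>1)"
    using m by (intro nn_integral_le_of_dominated sets dom1) auto
  also have "\<dots> = K1 * K2 * emeasure (\<nu>1 \<Otimes>\<^sub>M \<nu>2) A"
    using m by (simp add: nn_integral_cmult \<nu>2.emeasure_pair_measure_alt[OF A] mult.assoc)
  finally show ?thesis .
qed

lemma emeasure_density_le_of_le:
  assumes "f \<in> borel_measurable M" "g \<in> borel_measurable M"
    and "\<And>x. x \<in> space M \<Longrightarrow> f x \<le> K * g x" "A \<in> sets M"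
  shows "emeasure (density M f) A \<le> K * emeasure (density M g) A"
proof -
  have "emeasure (density M f) A \<le> (\<integral>\<^sup>+x. K * (g x * indicator A x) \<partial>M)"
    using assms by (subst emeasure_density)
      (auto intro!: nn_integral_mono split: split_indicator)
  also have "\<dots> = K * emeasure (density M g) A"
    using assms by (simp add: emeasure_density nn_integral_cmult)
  finally show ?thesis .
qed

lemma borel_measurable_prod_components:
  fixes u :: "'i \<Rightarrow> real \<Rightarrow> ennreal"
  assumes u: "\<And>j. j \<in> S \<Longrightarrow> u j \<in> borel_measurable borel"
  shows "(\<lambda>b. \<Prod>j\<in>S. u j (b j)) \<in> borel_measurable (PiM S (\<lambda>_. lborel))"
proof (rule borel_measurable_prod_ennreal)
  fix j assume j: "j \<in> S"
  have "(\<lambda>b. b j) \<in> PiM S (\<lambda>_. lborel) \<rightarrow>\<^sub>M borel"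
    using measurable_component_singleton[OF j, of "\<lambda>_. lborel"] by simp
  then show "(\<lambda>b. u j (b j)) \<in> borel_measurable (PiM S (\<lambda>_. lborel))"
    by (rule measurable_compose[OF _ u[OF j]])
qed

text \<open>One (z, \<beta>) block of the comparison distribution. An inactive block must be the
  point mass at \<open>(False, 0)\<close>, because \<open>slab_law\<close> gives it no other value
  and the comparison has to be dominated by it.\<close>

definition slab_factor :: "nat set \<Rightarrow> (nat \<Rightarrow> real \<Rightarrow> ennreal) \<Rightarrow> nat \<Rightarrow> (bool \<times> real) measure" where
  "slab_factor S u j = (if j \<in> S
     then distr (density lborel (u j)) (count_space UNIV \<Otimes>\<^sub>M borel) (Pair True)
     else return (count_space UNIV \<Otimes>\<^sub>M borel) (False, 0))"

lemma sets_slab_factor [simp, measurable_cong]: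
  "sets (slab_factor S u j) = sets (count_space UNIV \<Otimes>\<^sub>M borel)"
  by (simp add: slab_factor_def)

lemma prob_space_slab_factor:
  assumes [measurable]: "\<And>j. u j \<in> borel_measurable borel"
    and "\<And>j. j \<in> S \<Longrightarrow> (\<integral>\<^sup>+x. u j x \<partial>lborel) = 1"
  shows "prob_space (slab_factor S u j)"
proof (cases "j \<in> S")
  case True
  have "prob_space (density lborel (u j))"
    using assms(2)[OF True] by (intro prob_spaceI) (simp add: emeasure_density)
  then show ?thesis using True unfolding slab_factor_def
    by (simp add: prob_space.prob_space_distr)
next
  case False
  then show ?thesis unfolding slab_factor_def
    by (auto intro!: prob_space_return simp: space_pair_measure)
qed

text \<open>Presents the mean-field product as the image of a density on R^S under the very
  embedding that defines \<open>slab_law\<close>, so that the two can be compared by their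
  densities. Equality is verified on rectangles, where Tonelli splits the active
  coordinates.\<close>

lemma PiM_slab_factor:
  assumes S: "S \<subseteq> {..<d}" and u[measurable]: "\<And>j. u j \<in> borel_measurable borel"
    and u1: "\<And>j. j \<in> S \<Longrightarrow> (\<integral>\<^sup>+x. u j x \<partial>lborel) = 1"
  shows "PiM {..<d} (slab_factor S u) =
    distr (density (PiM S (\<lambda>_. lborel)) (\<lambda>b. \<Prod>j\<in>S. u j (b j))) (coef_space d)
      (\<lambda>b. \<lambda>j\<in>{..<d}. if j \<in> S then (True, b j) else (False, 0))"
    (is "_ = distr ?D _ ?e")
proof -
  have fin: "finite S" using S finite_subset by blast
  interpret slab: product_sigma_finite "slab_factor S u"
    by (simp add: product_sigma_finite_def prob_space_imp_sigma_finite prob_space_slab_factor u1)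
  interpret leb: product_sigma_finite "\<lambda>_::nat. lborel :: real measure"
    by (simp add: product_sigma_finite_def lborel.sigma_finite_measure_axioms)
  have U[measurable]: "(\<lambda>b. \<Prod>j\<in>S. u j (b j)) \<in> borel_measurable (PiM S (\<lambda>_. lborel))"
    by (rule borel_measurable_prod_components) (rule u)
  show ?thesis
  proof (rule slab.PiM_eqI[symmetric])
    show "sets (distr ?D (coef_space d) ?e) = sets (PiM {..<d} (slab_factor S u))"
      unfolding coef_space_def sets_distr by (intro sets_PiM_cong) auto
    fix A assume "\<And>j. j \<in> {..<d} \<Longrightarrow> A j \<in> sets (slab_factor S u j)"
    then have A[measurable]: "j < d \<Longrightarrow> A j \<in> sets (count_space UNIV \<Otimes>\<^sub>M borel)" for j by auto
    have PA: "PiE {..<d} A \<in> sets (coef_space d)"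
      unfolding coef_space_def by (intro sets_PiM_I_finite) (auto intro: A)
    let ?c = "\<Prod>j\<in>{..<d} - S. indicator (A j) (False, 0) :: ennreal"
    \<comment> \<open>Membership of the embedded point in a box separates into conditions on the
      active coordinates and a 0-1 constant for the inactive ones.\<close>
    have ind: "indicator (?e -` PiE {..<d} A \<inter> space (PiM S (\<lambda>_. lborel))) b
        = (\<Prod>j\<in>S. indicator (A j) (True, b j)) * ?c" if "b \<in> space (PiM S (\<lambda>_. lborel))" for b
    proof -
      have "?e b \<in> PiE {..<d} A \<longleftrightarrow> (\<forall>j\<in>S. (True, b j) \<in> A j) \<and> (\<forall>j\<in>{..<d} - S. (False, 0) \<in> A j)"
        using S by (auto simp: PiE_def Pi_def split: if_splits)
      moreover have "(\<Prod>j\<in>S. indicator (A j) (True, b j)) = (if \<forall>j\<in>S. (True, b j) \<in> A j then 1 else 0 :: ennreal)"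
        using fin by (auto simp: indicator_def prod_zero_iff)
      moreover have "?c = (if \<forall>j\<in>{..<d} - S. (False, 0) \<in> A j then 1 else 0)"
        by (auto simp: indicator_def prod_zero_iff)
      ultimately show ?thesis using that by (auto simp: indicator_def)
    qed
    have m: "(\<lambda>x. u j x * indicator (A j) (True, x)) \<in> borel_measurable lborel" if "j \<in> S" for j
    proof -
      have [measurable]: "A j \<in> sets (count_space UNIV \<Otimes>\<^sub>M borel)" using A S that by auto
      show ?thesis by measurable
    qed
    have D: "(\<integral>\<^sup>+b. (\<Prod>j\<in>S. u j (b j) * indicator (A j) (True, b j)) \<partial>PiM S (\<lambda>_. lborel))
      = (\<Prod>j\<in>S. \<integral>\<^sup>+x. u j x * indicator (A j) (True, x) \<partial>lborel)"
      by (rule leb.product_nn_integral_prod[OF fin m])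
    have m2: "(\<lambda>b. \<Prod>j\<in>S. u j (b j) * indicator (A j) (True, b j)) \<in> borel_measurable (PiM S (\<lambda>_. lborel))"
      using m by (intro borel_measurable_prod_components[of S "\<lambda>j x. u j x * indicator (A j) (True, x)"]) simp
    have "emeasure (distr ?D (coef_space d) ?e) (PiE {..<d} A)
        = emeasure ?D (?e -` PiE {..<d} A \<inter> space (PiM S (\<lambda>_. lborel)))"
      by (subst emeasure_distr) (use PA in auto)
    also have "\<dots> = (\<integral>\<^sup>+b. (\<Prod>j\<in>S. u j (b j)) *
        indicator (?e -` PiE {..<d} A \<inter> space (PiM S (\<lambda>_. lborel))) b \<partial>PiM S (\<lambda>_. lborel))"
      by (rule emeasure_density[OF U measurable_sets[OF measurable_slab_embedding PA]])
    also have "\<dots> = (\<integral>\<^sup>+b. (\<Prod>j\<in>S. u j (b j) * indicator (A j) (True, b j)) * ?c \<partial>PiM S (\<lambda>_. lborel))"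
      by (intro nn_integral_cong) (simp only: ind prod.distrib mult.assoc)
    also have "\<dots> = (\<Prod>j\<in>S. \<integral>\<^sup>+x. u j x * indicator (A j) (True, x) \<partial>lborel) * ?c"
      using m2 by (simp only: nn_integral_multc D)
    also have "\<dots> = (\<Prod>j\<in>S. emeasure (slab_factor S u j) (A j)) * (\<Prod>j\<in>{..<d} - S. emeasure (slab_factor S u j) (A j))"
    proof (intro arg_cong2[where f = "(*)"] prod.cong refl)
      fix j assume j: "j \<in> S"
      then have Aj[measurable]: "A j \<in> sets (count_space UNIV \<Otimes>\<^sub>M borel)" using A S by auto
      have "emeasure (slab_factor S u j) (A j) = emeasure (density lborel (u j)) (Pair True -` A j \<inter> space lborel)"
        using j unfolding slab_factor_def by (simp add: emeasure_distr)
      also have "\<dots> = (\<integral>\<^sup>+x. u j x * indicator (Pair True -` A j \<inter> space lborel) x \<partial>lborel)"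
      proof (rule emeasure_density)
        have "Pair True \<in> lborel \<rightarrow>\<^sub>M count_space UNIV \<Otimes>\<^sub>M borel" by simp
        then show "Pair True -` A j \<inter> space lborel \<in> sets lborel" using Aj by (rule measurable_sets)
      qed simp
      also have "\<dots> = (\<integral>\<^sup>+x. u j x * indicator (A j) (True, x) \<partial>lborel)"
        by (intro nn_integral_cong) (simp add: indicator_def)
      finally show "(\<integral>\<^sup>+x. u j x * indicator (A j) (True, x) \<partial>lborel) = emeasure (slab_factor S u j) (A j)" ..
    next
      fix j assume j: "j \<in> {..<d} - S"
      then show "indicator (A j) (False, 0) = emeasure (slab_factor S u j) (A j)"
        using A unfolding slab_factor_def by auto
    qed
    also have "\<dots> = (\<Prod>j\<in>{..<d}. emeasure (slab_factor S u j) (A j))"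
      using S by (subst prod.subset_diff[OF S]) (simp_all add: mult.commute)
    finally show "emeasure (distr ?D (coef_space d) ?e) (PiE {..<d} A)
      = (\<Prod>j\<in>{..<d}. emeasure (slab_factor S u j) (A j))" .
  qed simp
qed

text \<open>Both measures are images under the same embedding, so a pointwise inequality of
  densities on R^S transfers through preimages.\<close>

lemma PiM_slab_factor_le_slab_law:
  assumes S: "S \<subseteq> {..<d}" and u[measurable]: "\<And>j. u j \<in> borel_measurable borel"
    and u1: "\<And>j. j \<in> S \<Longrightarrow> (\<integral>\<^sup>+x. u j x \<partial>lborel) = 1"
    and slab: "slab_densities d slab"
    and le: "\<And>b. b \<in> S \<rightarrow>\<^sub>E UNIV \<Longrightarrow> (\<Prod>j\<in>S. u j (b j)) \<le> K * ennreal (slab S b)"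
    and A: "A \<in> sets (coef_space d)"
  shows "emeasure (PiM {..<d} (slab_factor S u)) A \<le> K * emeasure (slab_law d slab S) A"
proof -
  note [measurable] = slab_densitiesD(1)[OF slab S]
  have U[measurable]: "(\<lambda>b. \<Prod>j\<in>S. u j (b j)) \<in> borel_measurable (PiM S (\<lambda>_. lborel))"
    by (rule borel_measurable_prod_components) (rule u)
  have "emeasure (density (PiM S (\<lambda>_. lborel)) (\<lambda>b. \<Prod>j\<in>S. u j (b j))) B
      \<le> K * emeasure (density (PiM S (\<lambda>_. lborel)) (\<lambda>b. ennreal (slab S b))) B"
    if "B \<in> sets (PiM S (\<lambda>_. lborel))" for B
    using le that by (intro emeasure_density_le_of_le) (auto simp: space_PiM)
  moreover have "PiM {..<d} (slab_factor S u) =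
    distr (density (PiM S (\<lambda>_. lborel)) (\<lambda>b. \<Prod>j\<in>S. u j (b j))) (coef_space d)
      (\<lambda>b. \<lambda>j\<in>{..<d}. if j \<in> S then (True, b j) else (False, 0))"
    by (rule PiM_slab_factor[OF S]) (auto simp: u1)
  ultimately show ?thesis
    unfolding slab_law_def using A
    by (simp add: emeasure_distr measurable_sets[OF measurable_slab_embedding, simplified])
qed

section \<open>Log-likelihood loss in a neighbourhood of the truth\<close>

lemma neg_ln_normal_ratio_le:
  fixes n :: real
  assumes \<sigma>0: "0 < \<sigma>0" and \<sigma>: "\<sigma>0 \<le> \<sigma>" "\<sigma> \<le> \<sigma>0 + 1 / n" and n: "1 \<le> n"
    and \<mu>: "\<bar>\<mu> - \<mu>0\<bar> \<le> 1 / n"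
  shows "- ln (normal_density \<mu> \<sigma> y / normal_density \<mu>0 \<sigma>0 y)
    \<le> (1 / \<sigma>0 + 1 / \<sigma>0\<^sup>2 + (y - \<mu>0)\<^sup>2 / (2 * \<sigma>0\<^sup>2)) / n"
proof -
  define w \<delta> where "w = y - \<mu>0" and "\<delta> = \<mu> - \<mu>0"
  have yw: "y - \<mu>0 = w" "y - \<mu> = w - \<delta>" by (simp_all add: w_def \<delta>_def)
  have sp: "0 < \<sigma>" using \<sigma> \<sigma>0 by simp
  have ln: "ln (normal_density m s y) = - ln (sqrt (2 * pi)) - ln s - (y - m)\<^sup>2 / (2 * s\<^sup>2)"
    if "0 < s" for m s
    using that by (simp add: normal_density_def ln_mult ln_div real_sqrt_mult)
  have eq: "- ln (normal_density \<mu> \<sigma> y / normal_density \<mu>0 \<sigma>0 y)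
      = (ln \<sigma> - ln \<sigma>0) + ((w - \<delta>)\<^sup>2 / (2 * \<sigma>\<^sup>2) - w\<^sup>2 / (2 * \<sigma>0\<^sup>2))"
    using ln[OF \<sigma>0, of \<mu>0] ln[OF sp, of \<mu>] normal_density_pos[OF \<sigma>0, of \<mu>0 y] normal_density_pos[OF sp, of \<mu> y]
    by (simp add: ln_div yw)
  have "ln \<sigma> - ln \<sigma>0 = ln (\<sigma> / \<sigma>0)" using sp \<sigma>0 by (simp add: ln_div)
  also have "\<dots> \<le> \<sigma> / \<sigma>0 - 1" using sp \<sigma>0 by (intro ln_le_minus_one) simp
  also have "\<dots> = (\<sigma> - \<sigma>0) / \<sigma>0" using \<sigma>0 by (simp add: field_simps)
  also have "\<dots> \<le> (1 / n) / \<sigma>0" using \<sigma> \<sigma>0 by (intro divide_right_mono) auto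
  finally have 1: "ln \<sigma> - ln \<sigma>0 \<le> (1 / n) * (1 / \<sigma>0)" by simp
  \<comment> \<open>Here \<sigma> \<ge> \<sigma>0 matters: enlarging the scale can only shrink this
    quadratic term, so both terms may be put over the true variance.\<close>
  have "(w - \<delta>)\<^sup>2 / (2 * \<sigma>\<^sup>2) \<le> (w - \<delta>)\<^sup>2 / (2 * \<sigma>0\<^sup>2)"
    using \<sigma> \<sigma>0 by (intro divide_left_mono) (auto intro!: power_mono)
  then have "(w - \<delta>)\<^sup>2 / (2 * \<sigma>\<^sup>2) - w\<^sup>2 / (2 * \<sigma>0\<^sup>2) \<le> ((w - \<delta>)\<^sup>2 - w\<^sup>2) / (2 * \<sigma>0\<^sup>2)"
    by (simp add: diff_divide_distrib)
  also have "\<dots> \<le> ((1 / n) * (2 + w\<^sup>2)) / (2 * \<sigma>0\<^sup>2)"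
  proof (rule divide_right_mono)
    have d: "\<bar>\<delta>\<bar> \<le> 1 / n" using \<mu> by (simp add: \<delta>_def)
    have "1 / n \<le> 1" using n by simp
    then have "\<bar>\<delta>\<bar> \<le> 1" using d by linarith
    then have "\<delta>\<^sup>2 \<le> \<bar>\<delta>\<bar>" using mult_left_mono[of "\<bar>\<delta>\<bar>" 1 "\<bar>\<delta>\<bar>"] by (simp add: power2_eq_square)
    moreover have "- (2 * w * \<delta>) \<le> \<bar>\<delta>\<bar> * (1 + w\<^sup>2)"
    proof -
      \<comment> \<open>The cross term is linear in w; 2|w| \<le> 1 + w^2 trades it for the squared
        residual, whose sum is the one controlled on the event.\<close>
      have "2 * \<bar>w\<bar> \<le> 1 + w\<^sup>2" using sum_squares_bound[of "\<bar>w\<bar>" 1] by simp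
      then have "\<bar>\<delta>\<bar> * (2 * \<bar>w\<bar>) \<le> \<bar>\<delta>\<bar> * (1 + w\<^sup>2)" by (intro mult_left_mono) auto
      moreover have "- (2 * w * \<delta>) \<le> \<bar>\<delta>\<bar> * (2 * \<bar>w\<bar>)"
        using abs_ge_minus_self[of "2 * w * \<delta>"] by (simp add: abs_mult mult.commute mult.left_commute)
      ultimately show ?thesis by linarith
    qed
    ultimately have "(w - \<delta>)\<^sup>2 - w\<^sup>2 \<le> \<bar>\<delta>\<bar> * (2 + w\<^sup>2)"
      by (simp add: power2_diff algebra_simps)
    also have "\<dots> \<le> (1 / n) * (2 + w\<^sup>2)" by (rule mult_right_mono[OF d]) simp
    finally show "(w - \<delta>)\<^sup>2 - w\<^sup>2 \<le> (1 / n) * (2 + w\<^sup>2)" .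
  qed simp
  also have "\<dots> = (1 / n) * (1 / \<sigma>0\<^sup>2 + w\<^sup>2 / (2 * \<sigma>0\<^sup>2))"
    using \<sigma>0 n by (simp add: field_simps)
  finally have 2: "(w - \<delta>)\<^sup>2 / (2 * \<sigma>\<^sup>2) - w\<^sup>2 / (2 * \<sigma>0\<^sup>2) \<le> (1 / n) * (1 / \<sigma>0\<^sup>2 + w\<^sup>2 / (2 * \<sigma>0\<^sup>2))" .
  have "- ln (normal_density \<mu> \<sigma> y / normal_density \<mu>0 \<sigma>0 y)
      \<le> (1 / n) * (1 / \<sigma>0) + (1 / n) * (1 / \<sigma>0\<^sup>2 + w\<^sup>2 / (2 * \<sigma>0\<^sup>2))"
    unfolding eq using 1 2 by linarith
  also have "\<dots> = (1 / n) * (1 / \<sigma>0 + 1 / \<sigma>0\<^sup>2 + w\<^sup>2 / (2 * \<sigma>0\<^sup>2))" by (simp only: algebra_simps)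
  also have "\<dots> = (1 / \<sigma>0 + 1 / \<sigma>0\<^sup>2 + (y - \<mu>0)\<^sup>2 / (2 * \<sigma>0\<^sup>2)) / n" by (simp add: w_def)
  finally show ?thesis .
qed

text \<open>Each observation loses a multiple of 1/n, so the total over n observations is an average
  and is bounded through the mean squared residual \<open>L\<close>.\<close>

lemma neg_ln_likelihood_ratio_le:
  assumes \<theta>0: "0 < fst \<theta>0" and \<sigma>: "fst \<theta>0 \<le> fst \<theta>" "fst \<theta> \<le> fst \<theta>0 + 1 / real n" and n: "1 \<le> n"
    and \<mu>: "\<And>i. i < n \<Longrightarrow> \<bar>(\<Sum>j<d. X i j * snd (snd \<theta> j)) - (\<Sum>j<d. X i j * snd (snd \<theta>0 j))\<bar> \<le> 1 / real n"
    and R: "(\<Sum>i<n. (Y i - (\<Sum>j<d. X i j * snd (snd \<theta>0 j)))\<^sup>2) \<le> real n * L"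
  shows "- ln (likelihood X n d \<theta> Y / likelihood X n d \<theta>0 Y)
    \<le> 1 / fst \<theta>0 + 1 / (fst \<theta>0)\<^sup>2 + L / (2 * (fst \<theta>0)\<^sup>2)"
proof -
  let ?s = "fst \<theta>0"
  let ?w = "\<lambda>i. Y i - (\<Sum>j<d. X i j * snd (snd \<theta>0 j))"
  have np: "0 < real n" using n by simp
  have "- ln (likelihood X n d \<theta> Y / likelihood X n d \<theta>0 Y)
      = (\<Sum>i<n. - ln (obs_density X d \<theta> i (Y i) / obs_density X d \<theta>0 i (Y i)))"
    using \<theta>0 \<sigma> by (subst ln_likelihood_ratio) (auto simp: sum_negf)
  also have "\<dots> \<le> (\<Sum>i<n. (1 / ?s + 1 / ?s\<^sup>2 + (?w i)\<^sup>2 / (2 * ?s\<^sup>2)) / real n)"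
    unfolding obs_density_def using n
    by (intro sum_mono neg_ln_normal_ratio_le \<theta>0 \<sigma> \<mu>) auto
  also have "\<dots> = (real n * (1 / ?s + 1 / ?s\<^sup>2) + (\<Sum>i<n. (?w i)\<^sup>2) / (2 * ?s\<^sup>2)) / real n"
    by (simp add: sum_divide_distrib[symmetric] sum.distrib)
  also have "\<dots> \<le> (real n * (1 / ?s + 1 / ?s\<^sup>2) + real n * L / (2 * ?s\<^sup>2)) / real n"
    using R np by (intro divide_right_mono add_left_mono) auto
  also have "\<dots> = 1 / ?s + 1 / ?s\<^sup>2 + L / (2 * ?s\<^sup>2)" using np by (simp add: field_simps)
  finally show ?thesis .
qed

section \<open>The comparison distribution\<close>

lemma active_set_subset: "active_set d b \<subseteq> {..<d}"
  by (auto simp: active_set_def)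

lemma linear_predictor_param_of:
  "(\<Sum>j<d. X i j * snd (snd (param_of d b \<sigma>) j)) = (\<Sum>j\<in>active_set d b. X i j * b j)"
proof -
  have "(\<Sum>j<d. X i j * snd (snd (param_of d b \<sigma>) j)) = (\<Sum>j<d. X i j * b j)"
    by (intro sum.cong) (auto simp: param_of_def)
  also have "\<dots> = (\<Sum>j\<in>active_set d b. X i j * b j)"
    by (intro sum.mono_neutral_right) (auto simp: active_set_def)
  finally show ?thesis .
qed

text \<open>Inclusion probability 1/d makes the exclusion of all inactive coordinates cost only a
  constant. For x \<le> 1/2 one has ln (1 - x) \<ge> -x - 2 x^2 \<ge> -2x, and \<open>d\<close> such
  terms give -2.\<close>

lemma one_minus_inverse_power_ge:
  assumes "2 \<le> d"
  shows "exp (- 2) \<le> (1 - 1 / real d) ^ (d - k)"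
proof -
  define x where "x = 1 / real d"
  have x: "0 < x" "x \<le> 1 / 2" using assms by (auto simp: x_def field_simps)
  have "x * x \<le> x * (1 / 2)" using x by (intro mult_left_mono) auto
  then have "- 2 * x \<le> - x - 2 * x\<^sup>2" unfolding power2_eq_square by linarith
  also have "\<dots> \<le> ln (1 - x)" using x by (intro ln_one_minus_pos_lower_bound) auto
  finally have "real d * (- 2 * x) \<le> real d * ln (1 - x)" by (intro mult_left_mono) auto
  then have "- 2 \<le> real d * ln (1 - x)" using assms by (simp add: x_def)
  then have "exp (- 2) \<le> exp (real d * ln (1 - x))" by simp
  also have "\<dots> = (1 - x) ^ d" using x by (simp add: exp_of_nat_mult)
  also have "\<dots> \<le> (1 - x) ^ (d - k)" using x by (intro power_decreasing) auto
  finally show ?thesis by (simp add: x_def)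
qed

text \<open>The divergence bound is the logarithm of a product of domination factors:
  \<open>n / c\<close> for \<sigma>, the box density over the slab's lower bound, and the inverse
  prior probability of the true support.\<close>

lemma vb_candidate_exists:
  fixes d n :: nat and b :: "nat \<Rightarrow> real" and \<kappa> c \<sigma>0 :: real
  defines "S \<equiv> active_set d b"
  assumes psig: "psig \<in> borel_measurable borel" "\<And>\<sigma>. 0 \<le> psig \<sigma>" "(\<integral>\<^sup>+\<sigma>. ennreal (psig \<sigma>) \<partial>lborel) = 1"
    and c: "0 < c" "\<And>\<sigma>. \<sigma>0 \<le> \<sigma> \<Longrightarrow> \<sigma> \<le> \<sigma>0 + 1 / real n \<Longrightarrow> c \<le> psig \<sigma>"
    and slab: "slab_densities d slab"
    and reg: "poly_regular \<kappa> n d X S slab b"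
    and nd: "1 \<le> n" "2 \<le> d"
  shows "\<exists>q. block_mean_field d q \<and>
    KL q (prior d psig slab) \<le> ereal (ln (real n / c) + (2 * \<kappa> + 1) * real (card S) * ln (real d * real n)
      + real (card S) * ln (real d) + 2) \<and>
    (AE \<theta> in q. \<sigma>0 \<le> fst \<theta> \<and> fst \<theta> \<le> \<sigma>0 + 1 / real n \<and>
      (\<forall>i<n. \<bar>(\<Sum>j<d. X i j * snd (snd \<theta> j)) - (\<Sum>j\<in>S. X i j * b j)\<bar> \<le> 1 / real n))"
proof -
  let ?s = "card S" and ?N = "real d * real n"
  have S: "S \<subseteq> {..<d}" unfolding S_def by (rule active_set_subset)
  then have fin: "finite S" and sd: "?s \<le> d"
    using finite_subset card_mono[OF _ S] by auto
  have N1: "1 \<le> ?N" using nd mult_mono[of 1 "real d" 1 "real n"] by simp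
  have np: "0 < real n" and dp: "0 < real d" using nd by auto
  \<comment> \<open>The radius does two jobs: the box lies in the L2 ball where the slab is bounded
    below, as s r \<le> N^(-\<kappa>), and a predictor moves by at most s N^\<kappa> r = s / N \<le>
    1/n.\<close>
  define r where "r = ?N powr (- \<kappa> - 1)"
  have r: "0 < r" using N1 nd by (simp add: r_def)
  have rN: "r * ?N powr \<kappa> = 1 / ?N"
    unfolding r_def using N1 nd by (simp add: powr_add[symmetric] powr_minus_divide)
  have sr: "real ?s * r \<le> ?N powr (- \<kappa>)"
  proof -
    have "real ?s \<le> ?N" using sd nd mult_mono[of "real ?s" "real d" 1 "real n"] by simp
    then have "real ?s * r \<le> ?N * r" using r by (intro mult_right_mono) auto
    also have "?N * r = ?N powr 1 * r" using N1 nd by simp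
    also have "\<dots> = ?N powr (- \<kappa>)" unfolding r_def powr_add[symmetric] by simp
    finally show ?thesis .
  qed
  define J where "J j = {b j - r..b j + r}" for j
  define u :: "nat \<Rightarrow> real \<Rightarrow> ennreal" where "u j x = ennreal (1 / (2 * r)) * indicator (J j) x" for j x
  have u[measurable]: "u j \<in> borel_measurable borel" for j unfolding u_def J_def by measurable
  have u1: "(\<integral>\<^sup>+x. u j x \<partial>lborel) = 1" for j
    using r unfolding u_def J_def by (simp add: nn_integral_cmult ennreal_mult[symmetric])
  \<comment> \<open>Height of the uniform density on the box divided by the lower bound on the slab
    from \<open>poly_regular\<close>.\<close>
  define K2 where "K2 = (1 / (2 * r)) ^ ?s * ?N powr (\<kappa> * real ?s)"
  have K2: "0 < K2" using r N1 nd by (simp add: K2_def)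
  have le: "(\<Prod>j\<in>S. u j (x j)) \<le> ennreal K2 * ennreal (slab S x)" if x: "x \<in> S \<rightarrow>\<^sub>E UNIV" for x
  proof (cases "\<forall>j\<in>S. x j \<in> J j")
    case True
    have "L2_set (\<lambda>j. x j - b j) S \<le> (\<Sum>j\<in>S. \<bar>x j - b j\<bar>)" by (rule L2_set_le_sum_abs)
    also have "\<dots> \<le> (\<Sum>j\<in>S. r)"
      using True by (intro sum_mono) (auto simp: J_def abs_le_iff)
    also have "\<dots> \<le> ?N powr (- \<kappa>)" using sr by simp
    finally have "?N powr (- \<kappa> * real ?s) \<le> slab S x"
      using reg x unfolding poly_regular_def by blast
    then have "K2 * ?N powr (- \<kappa> * real ?s) \<le> K2 * slab S x" using K2 by (intro mult_left_mono) auto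
    moreover have "K2 * ?N powr (- \<kappa> * real ?s) = (1 / (2 * r)) ^ ?s"
      unfolding K2_def mult.assoc powr_add[symmetric] using N1 nd by simp
    moreover have "(\<Prod>j\<in>S. u j (x j)) = ennreal ((1 / (2 * r)) ^ ?s)"
      using True r by (simp add: u_def ennreal_power)
    ultimately have "(\<Prod>j\<in>S. u j (x j)) \<le> ennreal (K2 * slab S x)" by (metis ennreal_leI)
    then show ?thesis using K2 by (simp add: ennreal_mult')
  next
    case False
    then obtain j where "j \<in> S" "u j (x j) = 0" by (auto simp: u_def)
    then have "(\<Prod>j\<in>S. u j (x j)) = 0" using fin by (intro prod_zero) auto
    then show ?thesis by (simp only: zero_le)
  qed
  define Q where "Q = PiM {..<d} (slab_factor S u)"
  have factor: "prob_space (slab_factor S u j)" for j by (rule prob_space_slab_factor[OF u u1])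
  interpret Q: prob_space Q unfolding Q_def by (rule prob_space_PiM[OF factor])
  \<comment> \<open>A lower bound on the prior weight of \<open>S\<close>, with the exclusion
    probabilities replaced by exp (-2).\<close>
  define K3 where "K3 = (1 / real d) ^ ?s * exp (- 2)"
  have K3: "0 < K3" using nd by (simp add: K3_def)
  have Qdom: "emeasure Q A \<le> ennreal (K2 / K3) * emeasure (coef_prior d slab) A"
    if A: "A \<in> sets (coef_prior d slab)" for A
  proof -
    have A': "A \<in> sets (coef_space d)" using A by simp
    have "ennreal K3 * emeasure (slab_law d slab S) A \<le> ennreal ((1 / real d) ^ ?s * (1 - 1 / real d) ^ (d - ?s))
        * emeasure (slab_law d slab S) A"
      unfolding K3_def by (intro mult_right_mono ennreal_leI mult_left_mono one_minus_inverse_power_ge nd) auto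
    also have "\<dots> \<le> emeasure (coef_prior d slab) A"
      using nd by (intro slab_law_le_coef_prior slab S A') simp
    finally have *: "ennreal K3 * emeasure (slab_law d slab S) A \<le> emeasure (coef_prior d slab) A" .
    have "emeasure Q A \<le> ennreal K2 * emeasure (slab_law d slab S) A"
      unfolding Q_def by (rule PiM_slab_factor_le_slab_law[OF S u u1 slab le A'])
    also have "\<dots> = ennreal (K2 / K3) * (ennreal K3 * emeasure (slab_law d slab S) A)"
      using K2 K3 by (simp add: mult.assoc[symmetric] ennreal_mult'[symmetric])
    also have "\<dots> \<le> ennreal (K2 / K3) * emeasure (coef_prior d slab) A"
      by (rule mult_left_mono[OF *]) simp
    finally show ?thesis .
  qed
  define I where "I = {\<sigma>0..\<sigma>0 + 1 / real n}"
  have I[measurable]: "I \<in> sets borel" by (simp add: I_def)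
  define qs where "qs = density lborel (\<lambda>\<sigma>. ennreal (real n) * indicator I \<sigma>)"
  have "(\<integral>\<^sup>+\<sigma>. ennreal (real n) * indicator I \<sigma> \<partial>lborel) = 1"
    using np by (simp add: nn_integral_cmult I_def ennreal_mult[symmetric])
  then interpret qs: prob_space qs
    unfolding qs_def by (intro prob_spaceI) (simp add: emeasure_density)
  interpret pair: pair_prob_space qs Q ..
  have qs_dom: "emeasure qs A \<le> ennreal (real n / c) * emeasure (density lborel (\<lambda>\<sigma>. ennreal (psig \<sigma>))) A"
    if "A \<in> sets (density lborel (\<lambda>\<sigma>. ennreal (psig \<sigma>)))" for A
    unfolding qs_def
  proof (rule emeasure_density_le_of_le)
    fix \<sigma>
    have "ennreal (real n) \<le> ennreal (real n / c * psig \<sigma>)" if "\<sigma> \<in> I"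
    proof (rule ennreal_leI)
      have "real n / c * c \<le> real n / c * psig \<sigma>"
        using c that by (intro mult_left_mono) (auto simp: I_def)
      then show "real n \<le> real n / c * psig \<sigma>" using c by simp
    qed
    then show "ennreal (real n) * indicator I \<sigma> \<le> ennreal (real n / c) * ennreal (psig \<sigma>)"
      using c psig(2) by (auto simp: ennreal_mult[symmetric] split: split_indicator)
  qed (use that psig(1) in auto)
  interpret cp: prob_space "coef_prior d slab" by (rule prob_space_coef_prior[OF slab])
  have setsQ: "sets Q = sets (coef_space d)"
    unfolding Q_def coef_space_def by (intro sets_PiM_cong) auto
  have sets_q: "sets (qs \<Otimes>\<^sub>M Q) = sets (prior d psig slab)"
    unfolding sets_prior using setsQ by (intro sets_pair_measure_cong) (auto simp: qs_def)
  have "KL (qs \<Otimes>\<^sub>M Q) (prior d psig slab) \<le> ereal (ln (real n / c * (K2 / K3)))"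
  proof (rule KL_le_ln_of_dominated[OF prob_space_prior[OF psig(1,3) slab] pair.prob_space_axioms sets_q])
    fix A assume A: "A \<in> sets (prior d psig slab)"
    have "emeasure (qs \<Otimes>\<^sub>M Q) A \<le> ennreal (real n / c) * ennreal (K2 / K3) * emeasure (prior d psig slab) A"
      unfolding prior_eq
      by (rule emeasure_pair_le_of_dominated[OF Q.sigma_finite_measure_axioms
          cp.sigma_finite_measure_axioms _ _ qs_dom Qdom])
        (use A setsQ in \<open>auto simp: qs_def prior_eq\<close>)
    then show "emeasure (qs \<Otimes>\<^sub>M Q) A \<le> ennreal (real n / c * (K2 / K3)) * emeasure (prior d psig slab) A"
      using c K2 K3 by (simp add: ennreal_mult[symmetric])
  qed
  also have "ln (real n / c * (K2 / K3)) = ln (real n / c) + (ln K2 - ln K3)"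
    using np c K2 K3 by (simp add: ln_mult ln_div)
  also have "ln K3 = - (real ?s * ln (real d)) - 2"
    using dp by (simp add: K3_def ln_mult ln_realpow ln_div)
  also have "ln K2 = real ?s * (- ln (2 * r)) + \<kappa> * real ?s * ln ?N"
  proof -
    have "ln K2 = ln ((1 / (2 * r)) ^ ?s) + ln (?N powr (\<kappa> * real ?s))"
      unfolding K2_def using r N1 nd by (intro ln_mult_pos) auto
    also have "ln ((1 / (2 * r)) ^ ?s) = real ?s * (- ln (2 * r))"
      using r by (simp add: ln_realpow ln_div)
    also have "ln (?N powr (\<kappa> * real ?s)) = \<kappa> * real ?s * ln ?N" by (rule ln_powr)
    finally show ?thesis .
  qed
  also have "ereal (ln (real n / c) + (real ?s * (- ln (2 * r)) + \<kappa> * real ?s * ln ?N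
      - (- (real ?s * ln (real d)) - 2)))
    \<le> ereal (ln (real n / c) + (2 * \<kappa> + 1) * real ?s * ln ?N + real ?s * ln (real d) + 2)"
  proof -
    \<comment> \<open>Dropping the factor 2, each active coordinate costs (\<kappa> + 1) ln N for
      the box and \<kappa> ln N for the slab, which is the origin of 2 \<kappa> + 1.\<close>
    have "ln r \<le> ln (2 * r)" using r by simp
    moreover have "ln r = (- \<kappa> - 1) * ln ?N" unfolding r_def by (rule ln_powr)
    ultimately have "- ln (2 * r) \<le> (\<kappa> + 1) * ln ?N" by (simp add: algebra_simps)
    then have "real ?s * (- ln (2 * r)) \<le> real ?s * ((\<kappa> + 1) * ln ?N)" by (intro mult_left_mono) auto
    then have "real ?s * (- ln (2 * r)) + \<kappa> * real ?s * ln ?N \<le> (2 * \<kappa> + 1) * real ?s * ln ?N"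
      by (simp add: algebra_simps)
    then show ?thesis by simp
  qed
  finally have KL: "KL (qs \<Otimes>\<^sub>M Q) (prior d psig slab) \<le> ereal (ln (real n / c)
      + (2 * \<kappa> + 1) * real ?s * ln ?N + real ?s * ln (real d) + 2)" .
  have bmf: "block_mean_field d (qs \<Otimes>\<^sub>M Q)"
    unfolding block_mean_field_def Q_def
    using qs.prob_space_axioms factor
    by (intro exI[of _ qs] exI[of _ "slab_factor S u"]) (auto simp: qs_def)
  define near where "near \<omega> \<longleftrightarrow> (\<forall>i<n. \<bar>(\<Sum>j<d. X i j * snd (\<omega> j)) - (\<Sum>j\<in>S. X i j * b j)\<bar> \<le> 1 / real n)"
    for \<omega> :: "nat \<Rightarrow> bool \<times> real"
  note [measurable_cong] = setsQ
  have coef[measurable]: "(\<lambda>\<omega>. \<Sum>j<d. X i j * snd (\<omega> j)) \<in> borel_measurable (coef_space d)" for i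
  proof -
    have "(\<lambda>\<omega>. \<omega> j) \<in> coef_space d \<rightarrow>\<^sub>M count_space UNIV \<Otimes>\<^sub>M borel" if "j < d" for j
      unfolding coef_space_def using that by (intro measurable_component_singleton) auto
    then show ?thesis
      by (intro borel_measurable_sum borel_measurable_times borel_measurable_const
          measurable_compose[OF _ measurable_snd]) auto
  qed
  have near[measurable]: "Measurable.pred (coef_space d) near" unfolding near_def by measurable
  let ?e = "\<lambda>x. \<lambda>j\<in>{..<d}. if j \<in> S then (True, x j) else (False, 0 :: real)"
  have near_box: "near (?e x)" if x: "\<forall>j\<in>S. x j \<in> J j" for x
    unfolding near_def
  proof (intro allI impI)
    fix i assume i: "i < n"
    have "(\<Sum>j<d. X i j * snd (?e x j)) = (\<Sum>j<d. if j \<in> S then X i j * x j else 0)"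
      by (intro sum.cong) auto
    also have "\<dots> = (\<Sum>j\<in>S. X i j * x j)"
      using S by (simp add: sum.If_cases Int_absorb1)
    finally have "(\<Sum>j<d. X i j * snd (?e x j)) - (\<Sum>j\<in>S. X i j * b j) = (\<Sum>j\<in>S. X i j * (x j - b j))"
      by (simp add: sum_subtractf right_diff_distrib)
    also have "\<bar>\<dots>\<bar> \<le> (\<Sum>j\<in>S. ?N powr \<kappa> * r)"
    proof (rule order.trans[OF sum_abs], rule sum_mono)
      fix j assume j: "j \<in> S"
      have "\<bar>X i j\<bar> \<le> ?N powr \<kappa>" using reg i j unfolding poly_regular_def by blast
      moreover have "\<bar>x j - b j\<bar> \<le> r" using x j by (auto simp: J_def abs_le_iff)
      ultimately show "\<bar>X i j * (x j - b j)\<bar> \<le> ?N powr \<kappa> * r"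
        unfolding abs_mult by (intro mult_mono) auto
    qed
    also have "\<dots> = real ?s / ?N" using rN by (simp add: mult.commute)
    also have "\<dots> \<le> real d / ?N" using sd N1 by (intro divide_right_mono) auto
    also have "\<dots> = 1 / real n" using dp by simp
    finally show "\<bar>(\<Sum>j<d. X i j * snd (?e x j)) - (\<Sum>j\<in>S. X i j * b j)\<bar> \<le> 1 / real n" .
  qed
  \<comment> \<open>Through the image representation of \<open>Q\<close>, the claim is pulled back
    to R^S, where a positive density forces every active coordinate into its interval.\<close>
  have aeQ: "AE \<omega> in Q. near \<omega>"
  proof -
    have U: "(\<lambda>x. \<Prod>j\<in>S. u j (x j)) \<in> borel_measurable (PiM S (\<lambda>_. lborel))"
      by (rule borel_measurable_prod_components) (rule u)
    have "AE x in density (PiM S (\<lambda>_. lborel)) (\<lambda>x. \<Prod>j\<in>S. u j (x j)). near (?e x)"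
      unfolding AE_density[OF U]
    proof (rule AE_I2, rule impI)
      fix x assume "0 < (\<Prod>j\<in>S. u j (x j))"
      then have "\<forall>j\<in>S. u j (x j) \<noteq> 0" using prod_zero[OF fin, of "\<lambda>j. u j (x j)"] by (metis less_irrefl)
      then have "\<forall>j\<in>S. x j \<in> J j" by (auto simp: u_def indicator_def split: if_splits)
      then show "near (?e x)" by (rule near_box)
    qed
    moreover have Q_eq: "Q = distr (density (PiM S (\<lambda>_. lborel)) (\<lambda>x. \<Prod>j\<in>S. u j (x j))) (coef_space d) ?e"
      unfolding Q_def by (rule PiM_slab_factor[OF S]) (auto simp: u1)
    ultimately show ?thesis
      unfolding Q_eq by (subst AE_distr_iff) auto
  qed
  have aeqs: "AE \<sigma> in qs. \<sigma> \<in> I"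
    unfolding qs_def by (subst AE_density) (auto split: split_indicator)
  have qs_sets[measurable_cong]: "sets qs = sets borel" by (simp add: qs_def)
  have "AE \<theta> in qs \<Otimes>\<^sub>M Q. fst \<theta> \<in> I \<and> near (snd \<theta>)"
  proof (rule pair.AE_pair_measure)
    show "{\<theta> \<in> space (qs \<Otimes>\<^sub>M Q). fst \<theta> \<in> I \<and> near (snd \<theta>)} \<in> sets (qs \<Otimes>\<^sub>M Q)" by measurable
    show "AE \<sigma> in qs. AE \<omega> in Q. fst (\<sigma>, \<omega>) \<in> I \<and> near (snd (\<sigma>, \<omega>))"
      using aeqs by eventually_elim (use aeQ in auto)
  qed
  then have "AE \<theta> in qs \<Otimes>\<^sub>M Q. \<sigma>0 \<le> fst \<theta> \<and> fst \<theta> \<le> \<sigma>0 + 1 / real n \<and>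
      (\<forall>i<n. \<bar>(\<Sum>j<d. X i j * snd (snd \<theta> j)) - (\<Sum>j\<in>S. X i j * b j)\<bar> \<le> 1 / real n)"
    by eventually_elim (auto simp: I_def near_def)
  then show ?thesis using bmf KL by blast
qed

section \<open>The contraction rate\<close>

text \<open>A bound at a single sample size with explicit failure probability. \<open>C\<close>
  depends on \<sigma>0, \<open>c\<close> and \<kappa> only, which lets the theorem fix it before the
  design, the sparsity and \<alpha>.\<close>

lemma vb_contraction_at_sample_size:
  fixes d n :: nat and b :: "nat \<Rightarrow> real" and \<kappa> c \<sigma>0 \<alpha> :: real
  defines "s \<equiv> card (active_set d b)" and "\<theta>0 \<equiv> param_of d b \<sigma>0"
    and "C \<equiv> 1 / \<sigma>0 + 1 / \<sigma>0\<^sup>2 + 1 / (2 * \<sigma>0\<^sup>2) + \<bar>ln c\<bar> + 2 * \<kappa> + 6"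
  assumes psig: "psig \<in> borel_measurable borel" "\<And>\<sigma>. 0 \<le> psig \<sigma>" "(\<integral>\<^sup>+\<sigma>. ennreal (psig \<sigma>) \<partial>lborel) = 1"
    and \<sigma>0: "0 < \<sigma>0"
    and c: "0 < c" "\<And>\<sigma>. \<sigma>0 \<le> \<sigma> \<Longrightarrow> \<sigma> \<le> \<sigma>0 + 1 / real n \<Longrightarrow> c \<le> psig \<sigma>"
    and slab: "slab_densities d slab"
    and reg: "poly_regular \<kappa> n d X (active_set d b) slab b"
    and nd: "1 \<le> n" "2 \<le> d" "1 \<le> ln (real d * real n)" and s: "1 \<le> s"
    and \<alpha>: "0 < \<alpha>" "\<alpha> < 1"
    and vb: "AE Y in data_law X n d \<theta>0. vb_solution d \<alpha> (\<lambda>\<theta>. likelihood X n d \<theta> Y) \<theta>0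
        (prior d psig slab) (qhat Y)"
  shows "\<exists>A\<in>sets (data_law X n d \<theta>0).
    1 - 1 / (real d * real n) - \<sigma>0\<^sup>2 / ln (real d * real n) \<le> measure (data_law X n d \<theta>0) A \<and>
    (\<forall>Y\<in>A. sqrt (\<integral>\<theta>. avg_hellinger_sq X n d \<theta> \<theta>0 \<partial>qhat Y)
      \<le> sqrt C * sqrt (real s / (real n * min \<alpha> (1 - \<alpha>)) * ln (real d * real n)))"
proof -
  let ?N = "real d * real n" and ?m = "min \<alpha> (1 - \<alpha>)"
  \<comment> \<open>\<open>L\<close> is both ln M for M = d n and the threshold for the mean squared
    residual. It grows, so the failure probability \<sigma>0^2 / L vanishes, yet it adds only O(L)
    to the loss, within the target rate.\<close>
  define L where "L = ln ?N"
  have L1: "1 \<le> L" using nd by (simp add: L_def)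
  have np: "0 < real n" and dp: "0 < real d" using nd by auto
  then have Np: "0 < ?N" by simp
  have mp: "0 < ?m" using \<alpha> by simp
  have fst0: "fst \<theta>0 = \<sigma>0" by (simp add: \<theta>0_def param_of_def)
  define k where "k = ln (real n / c) + (2 * \<kappa> + 1) * real s * L + real s * ln (real d) + 2"
  obtain q where q: "block_mean_field d q" "KL q (prior d psig slab) \<le> ereal k"
    and ae: "AE \<theta> in q. \<sigma>0 \<le> fst \<theta> \<and> fst \<theta> \<le> \<sigma>0 + 1 / real n \<and>
      (\<forall>i<n. \<bar>(\<Sum>j<d. X i j * snd (snd \<theta> j)) - (\<Sum>j\<in>active_set d b. X i j * b j)\<bar> \<le> 1 / real n)"
    using vb_candidate_exists[OF psig c slab reg nd(1,2)] unfolding k_def s_def L_def by blast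
  define G where "G = 1 / \<sigma>0 + 1 / \<sigma>0\<^sup>2 + L / (2 * \<sigma>0\<^sup>2)"
  have G0: "0 \<le> G" using \<sigma>0 L1 by (simp add: G_def)
  have "\<exists>A\<in>sets (data_law X n d \<theta>0). 1 - 1 / ?N - (fst \<theta>0)\<^sup>2 / L \<le> measure (data_law X n d \<theta>0) A \<and>
    (\<forall>Y\<in>A. ?m * real n * (\<integral>\<theta>. avg_hellinger_sq X n d \<theta> \<theta>0 \<partial>qhat Y) \<le> \<alpha> * (G + k / \<alpha>) + ln ?N)"
  proof (rule vb_high_probability_bound[OF psig(1,3) slab _ \<alpha> vb q(1) _ Np _ nd(1)])
    fix Y assume R: "(\<Sum>i<n. (Y i - (\<Sum>j<d. X i j * snd (snd \<theta>0 j)))\<^sup>2) \<le> real n * L"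
    show "vb_objective \<alpha> (\<lambda>\<theta>. likelihood X n d \<theta> Y) \<theta>0 (prior d psig slab) q \<le> ereal (G + k / \<alpha>)"
    proof (rule vb_objective_le[OF block_mean_field_prob(1)[OF q(1)] \<alpha>(1) _ G0 q(2)])
      show "AE \<theta> in q. - ln (likelihood X n d \<theta> Y / likelihood X n d \<theta>0 Y) \<le> G"
        using ae
      proof eventually_elim
        case (elim \<theta>)
        have \<mu>0: "(\<Sum>j<d. X i j * snd (snd \<theta>0 j)) = (\<Sum>j\<in>active_set d b. X i j * b j)" for i
          unfolding \<theta>0_def by (rule linear_predictor_param_of)
        show ?case
          unfolding G_def fst0[symmetric]
          by (rule neg_ln_likelihood_ratio_le) (use elim R nd \<sigma>0 in \<open>auto simp: fst0 \<mu>0\<close>)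
      qed
    qed
  qed (use \<sigma>0 L1 fst0 in auto)
  then obtain A where A: "A \<in> sets (data_law X n d \<theta>0)"
      "1 - 1 / ?N - \<sigma>0\<^sup>2 / L \<le> measure (data_law X n d \<theta>0) A"
    and le: "\<And>Y. Y \<in> A \<Longrightarrow> ?m * real n * (\<integral>\<theta>. avg_hellinger_sq X n d \<theta> \<theta>0 \<partial>qhat Y)
      \<le> \<alpha> * (G + k / \<alpha>) + L"
    unfolding fst0 L_def by blast
  have bound: "\<alpha> * (G + k / \<alpha>) + L \<le> C * (real s * L)"
  proof -
    \<comment> \<open>The target order s ln (d n). Because s \<ge> 1 and L \<ge> 1, constants, s and
      L are all absorbed into it.\<close>
    define T where "T = real s * L"
    have T: "1 \<le> T" "L \<le> T" "real s \<le> T"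
      using s L1 mult_mono[of 1 "real s" 1 L] mult_right_mono[of 1 "real s" L]
        mult_left_mono[of 1 L "real s"] by (auto simp: T_def)
    \<comment> \<open>The divergence keeps coefficient one and the loss gets \<alpha> < 1, so the
      bound is uniform in \<alpha>.\<close>
    have "\<alpha> * (G + k / \<alpha>) = \<alpha> * G + k" using \<alpha> by (simp add: algebra_simps)
    also have "\<dots> \<le> G + k" using \<alpha> G0 by (simp add: mult_left_le_one_le)
    finally have 1: "\<alpha> * (G + k / \<alpha>) + L \<le> G + k + L" by simp
    have "L / (2 * \<sigma>0\<^sup>2) = 1 / (2 * \<sigma>0\<^sup>2) * L" by simp
    also have "\<dots> \<le> 1 / (2 * \<sigma>0\<^sup>2) * T" using T by (intro mult_left_mono) auto
    finally have 2: "L / (2 * \<sigma>0\<^sup>2) \<le> 1 / (2 * \<sigma>0\<^sup>2) * T" .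
    have 3: "1 / \<sigma>0 \<le> 1 / \<sigma>0 * T" "1 / \<sigma>0\<^sup>2 \<le> 1 / \<sigma>0\<^sup>2 * T" "\<bar>ln c\<bar> \<le> \<bar>ln c\<bar> * T"
      using T \<sigma>0 mult_left_mono[OF T(1), of "1 / \<sigma>0"] mult_left_mono[OF T(1), of "1 / \<sigma>0\<^sup>2"]
        mult_left_mono[OF T(1), of "\<bar>ln c\<bar>"] by auto
    have Lsum: "L = ln (real d) + ln (real n)" using np dp by (simp add: L_def ln_mult)
    have lnn: "0 \<le> ln (real n)" "0 \<le> ln (real d)" using nd by auto
    have "ln (real n / c) = ln (real n) - ln c" using np c by (simp add: ln_div)
    then have 4: "ln (real n / c) \<le> T + \<bar>ln c\<bar>" using Lsum lnn T by linarith
    have "real s * ln (real d) \<le> real s * L" using Lsum lnn by (intro mult_left_mono) auto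
    then have 5: "real s * ln (real d) \<le> T" by (simp add: T_def)
    have 6: "(2 * \<kappa> + 1) * real s * L = 2 * \<kappa> * T + T" by (simp add: T_def algebra_simps)
    \<comment> \<open>The six units of \<open>T\<close>: one for ln n, one beside 2 \<kappa> in the
      box and slab cost, one for s ln d, two for the constant 2, and one for the added
      \<open>L\<close>.\<close>
    have "G + k + L \<le> 1 / \<sigma>0 * T + 1 / \<sigma>0\<^sup>2 * T + 1 / (2 * \<sigma>0\<^sup>2) * T + \<bar>ln c\<bar> * T + 2 * \<kappa> * T + 6 * T"
      unfolding G_def k_def using 2 3 4 5 6 T by linarith
    also have "\<dots> = C * T" by (simp only: C_def distrib_right)
    finally show ?thesis using 1 by (simp add: T_def)
  qed
  show ?thesis
  proof (intro bexI[OF _ A(1)] conjI ballI)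
    show "1 - 1 / ?N - \<sigma>0\<^sup>2 / ln ?N \<le> measure (data_law X n d \<theta>0) A" using A(2) by (simp add: L_def)
    fix Y assume "Y \<in> A"
    from order.trans[OF le[OF this] bound]
    have "(\<integral>\<theta>. avg_hellinger_sq X n d \<theta> \<theta>0 \<partial>qhat Y) * (real n * ?m) \<le> C * (real s * L)"
      by (simp add: mult_ac)
    then have "(\<integral>\<theta>. avg_hellinger_sq X n d \<theta> \<theta>0 \<partial>qhat Y) \<le> C * (real s * L) / (real n * ?m)"
      using np mp by (subst pos_le_divide_eq) auto
    also have "\<dots> = C * (real s / (real n * ?m) * L)" by simp
    finally show "sqrt (\<integral>\<theta>. avg_hellinger_sq X n d \<theta> \<theta>0 \<partial>qhat Y)
        \<le> sqrt C * sqrt (real s / (real n * ?m) * ln ?N)"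
      unfolding L_def real_sqrt_mult[symmetric] by (rule real_sqrt_le_mono)
  qed
qed

text \<open>The constant needs only a local lower bound on the \<sigma>-prior, its true value and
  \<kappa>, so it precedes all quantities that vary with n. What remains is to make the bound at
  each large n effective in the limit.\<close>

theorem corollary4p2:
  fixes psig :: "real \<Rightarrow> real" and sigstar \<kappa> :: real
  assumes "psig \<in> borel_measurable borel"
    and "\<And>\<sigma>. 0 \<le> psig \<sigma>"
    and "\<And>\<sigma>. \<sigma> \<le> 0 \<Longrightarrow> psig \<sigma> = 0"
    and "(\<integral>\<^sup>+\<sigma>. ennreal (psig \<sigma>) \<partial>lborel) = 1"
    and "0 < sigstar"
    and "isCont psig sigstar"
    and "0 < psig sigstar"
    and "0 < \<kappa>"
  shows "\<exists>C>0. \<forall>(d :: nat \<Rightarrow> nat) (s :: nat \<Rightarrow> nat) (X :: nat \<Rightarrow> nat \<Rightarrow> nat \<Rightarrow> real)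
      (bstar :: nat \<Rightarrow> nat \<Rightarrow> real) (slab :: nat \<Rightarrow> nat set \<Rightarrow> (nat \<Rightarrow> real) \<Rightarrow> real)
      (\<alpha> :: real) (qhat :: nat \<Rightarrow> (nat \<Rightarrow> real) \<Rightarrow> param measure).
    (\<lambda>n. real n) \<in> o(\<lambda>n. real (d n)) \<and>
    (\<lambda>n. real (s n)) \<in> o(\<lambda>n. real n) \<and>
    ((\<lambda>n. real (s n) * ln (real (d n)) / real n) \<longlonglongrightarrow> 0) \<and>
    (\<forall>n. card (active_set (d n) (bstar n)) = s n) \<and>
    (\<forall>\<^sub>F n in sequentially. 1 \<le> s n) \<and>
    (\<forall>n. slab_densities (d n) (slab n)) \<and>
    (\<forall>n. slab_continuous_thick (active_set (d n) (bstar n)) (slab n) (bstar n)) \<and>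
    (\<forall>\<^sub>F n in sequentially.
       poly_regular \<kappa> n (d n) (X n) (active_set (d n) (bstar n)) (slab n) (bstar n)) \<and>
    0 < \<alpha> \<and> \<alpha> < 1 \<and>
    (\<forall>n. AE Y in data_law (X n) n (d n) (param_of (d n) (bstar n) sigstar).
       vb_solution (d n) \<alpha> (\<lambda>\<theta>. likelihood (X n) n (d n) \<theta> Y)
         (param_of (d n) (bstar n) sigstar) (prior (d n) psig (slab n)) (qhat n Y))
    \<longrightarrow>
    with_prob_tending_to_one
      (\<lambda>n. data_law (X n) n (d n) (param_of (d n) (bstar n) sigstar))
      (\<lambda>n Y. sqrt (\<integral>\<theta>. avg_hellinger_sq (X n) n (d n) \<theta>
                          (param_of (d n) (bstar n) sigstar) \<partial>qhat n Y)
        \<le> C * sqrt (real (s n) / (real n * min \<alpha> (1 - \<alpha>)) * ln (real (d n) * real n)))"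
proof -
  \<comment> \<open>By continuity the prior density stays above half its value at the truth on a
    neighbourhood, which contains the interval of length 1/n once 1/n < \<delta>.\<close>
  define c where "c = psig sigstar / 2"
  have c: "0 < c" using assms(7) by (simp add: c_def)
  define C where "C = 1 / sigstar + 1 / sigstar\<^sup>2 + 1 / (2 * sigstar\<^sup>2) + \<bar>ln c\<bar> + 2 * \<kappa> + 6"
  have C: "0 < C" using assms(5,8) by (simp add: C_def add_pos_nonneg)
  have "\<forall>\<^sub>F \<sigma> in at sigstar. c < psig \<sigma>"
    using assms(6,7) unfolding isCont_def by (intro order_tendstoD) (auto simp: c_def)
  then obtain \<delta> where \<delta>: "0 < \<delta>" "\<And>\<sigma>. \<sigma> \<noteq> sigstar \<Longrightarrow> dist \<sigma> sigstar < \<delta> \<Longrightarrow> c < psig \<sigma>"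
    unfolding eventually_at by blast
  have cpsig: "c \<le> psig \<sigma>" if "sigstar \<le> \<sigma>" "\<sigma> \<le> sigstar + 1 / real n" "1 / real n < \<delta>" for \<sigma> n
    using \<delta>(2)[of \<sigma>] that c by (cases "\<sigma> = sigstar") (auto simp: c_def dist_real_def)
  show ?thesis
  proof (rule exI[of _ "sqrt C"], intro conjI allI impI)
    show "0 < sqrt C" using C by simp
    fix d s :: "nat \<Rightarrow> nat" and X :: "nat \<Rightarrow> nat \<Rightarrow> nat \<Rightarrow> real" and bstar :: "nat \<Rightarrow> nat \<Rightarrow> real"
      and slab :: "nat \<Rightarrow> nat set \<Rightarrow> (nat \<Rightarrow> real) \<Rightarrow> real" and \<alpha> :: real
      and qhat :: "nat \<Rightarrow> (nat \<Rightarrow> real) \<Rightarrow> param measure"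
    assume H: "(\<lambda>n. real n) \<in> o(\<lambda>n. real (d n)) \<and>
      (\<lambda>n. real (s n)) \<in> o(\<lambda>n. real n) \<and>
      ((\<lambda>n. real (s n) * ln (real (d n)) / real n) \<longlonglongrightarrow> 0) \<and>
      (\<forall>n. card (active_set (d n) (bstar n)) = s n) \<and>
      (\<forall>\<^sub>F n in sequentially. 1 \<le> s n) \<and>
      (\<forall>n. slab_densities (d n) (slab n)) \<and>
      (\<forall>n. slab_continuous_thick (active_set (d n) (bstar n)) (slab n) (bstar n)) \<and>
      (\<forall>\<^sub>F n in sequentially.
         poly_regular \<kappa> n (d n) (X n) (active_set (d n) (bstar n)) (slab n) (bstar n)) \<and>
      0 < \<alpha> \<and> \<alpha> < 1 \<and>
      (\<forall>n. AE Y in data_law (X n) n (d n) (param_of (d n) (bstar n) sigstar).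
         vb_solution (d n) \<alpha> (\<lambda>\<theta>. likelihood (X n) n (d n) \<theta> Y)
           (param_of (d n) (bstar n) sigstar) (prior (d n) psig (slab n)) (qhat n Y))"
    define M where "M n = data_law (X n) n (d n) (param_of (d n) (bstar n) sigstar)" for n
    define P where "P n Y \<longleftrightarrow> sqrt (\<integral>\<theta>. avg_hellinger_sq (X n) n (d n) \<theta>
                          (param_of (d n) (bstar n) sigstar) \<partial>qhat n Y)
        \<le> sqrt C * sqrt (real (s n) / (real n * min \<alpha> (1 - \<alpha>)) * ln (real (d n) * real n))" for n Y
    have prob: "prob_space (M n)" for n
      unfolding M_def using assms(5) by (intro prob_space_data_law) (simp add: param_of_def)
    have "\<forall>\<^sub>F n in sequentially. norm (real n) \<le> 1 * norm (real (d n))"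
      using H by (intro landau_o.smallD) auto
    moreover have "\<forall>\<^sub>F n in sequentially. 1 / real n < \<delta>"
      using order_tendstoD(2)[OF lim_1_over_n \<delta>(1)] by simp
    moreover have ev_s: "\<forall>\<^sub>F n in sequentially. 1 \<le> s n"
      and ev_reg: "\<forall>\<^sub>F n in sequentially.
        poly_regular \<kappa> n (d n) (X n) (active_set (d n) (bstar n)) (slab n) (bstar n)"
      using H by blast+
    ultimately have ev: "\<forall>\<^sub>F n in sequentially. 3 \<le> n \<and> n \<le> d n \<and> 1 / real n < \<delta> \<and> 1 \<le> s n \<and>
        poly_regular \<kappa> n (d n) (X n) (active_set (d n) (bstar n)) (slab n) (bstar n)"
      using eventually_ge_at_top[of 3] ev_s ev_reg by eventually_elim auto
    \<comment> \<open>The failure probability is weakened to one depending on n alone, using d n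
      \<ge> n; n \<ge> 3 exceeds e, so ln n \<ge> 1.\<close>
    have step: "\<exists>A\<in>sets (M n). 1 - 1 / real n - sigstar\<^sup>2 / ln (real n) \<le> measure (M n) A \<and> (\<forall>Y\<in>A. P n Y)"
      if n: "3 \<le> n" "n \<le> d n" "1 / real n < \<delta>" "1 \<le> s n"
        "poly_regular \<kappa> n (d n) (X n) (active_set (d n) (bstar n)) (slab n) (bstar n)" for n
    proof -
      have N: "real n \<le> real (d n) * real n" using n mult_right_mono[of 1 "real (d n)" "real n"] by simp
      have "exp 1 \<le> real n" using n exp_le by linarith
      then have lnn: "1 \<le> ln (real n)" using n by (subst ln_ge_iff) auto
      have lnN: "ln (real n) \<le> ln (real (d n) * real n)" using n N by simp
      have "\<exists>A\<in>sets (M n). 1 - 1 / (real (d n) * real n) - sigstar\<^sup>2 / ln (real (d n) * real n)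
          \<le> measure (M n) A \<and> (\<forall>Y\<in>A. P n Y)"
      proof -
        have sn: "card (active_set (d n) (bstar n)) = s n" using H by blast
        have vb: "AE Y in data_law (X n) n (d n) (param_of (d n) (bstar n) sigstar).
          vb_solution (d n) \<alpha> (\<lambda>\<theta>. likelihood (X n) n (d n) \<theta> Y)
            (param_of (d n) (bstar n) sigstar) (prior (d n) psig (slab n)) (qhat n Y)"
          and sl: "slab_densities (d n) (slab n)" and \<alpha>: "0 < \<alpha>" "\<alpha> < 1" using H by blast+
        show ?thesis
          unfolding M_def P_def C_def sn[symmetric]
          by (rule vb_contraction_at_sample_size[OF assms(1,2,4,5) c cpsig[OF _ _ n(3)] sl n(5) _ _ _ _ \<alpha> vb])
            (use n order.trans[OF lnn lnN] sn in auto)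
      qed
      moreover have "1 / (real (d n) * real n) \<le> 1 / real n" using n N by (intro divide_left_mono) auto
      moreover have "sigstar\<^sup>2 / ln (real (d n) * real n) \<le> sigstar\<^sup>2 / ln (real n)"
        using lnn lnN by (intro divide_left_mono) auto
      ultimately show ?thesis by (meson diff_mono order.trans order_refl)
    qed
    \<comment> \<open>For the sample sizes where the conditions fail the empty event is chosen; they
      do not affect the limit.\<close>
    have "\<forall>n. \<exists>A. A \<in> sets (M n) \<and> (\<forall>Y\<in>A. P n Y) \<and>
      (3 \<le> n \<and> n \<le> d n \<and> 1 / real n < \<delta> \<and> 1 \<le> s n \<and>
        poly_regular \<kappa> n (d n) (X n) (active_set (d n) (bstar n)) (slab n) (bstar n)
        \<longrightarrow> 1 - 1 / real n - sigstar\<^sup>2 / ln (real n) \<le> measure (M n) A)"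
    proof
      fix n
      show "\<exists>A. A \<in> sets (M n) \<and> (\<forall>Y\<in>A. P n Y) \<and>
        (3 \<le> n \<and> n \<le> d n \<and> 1 / real n < \<delta> \<and> 1 \<le> s n \<and>
          poly_regular \<kappa> n (d n) (X n) (active_set (d n) (bstar n)) (slab n) (bstar n)
          \<longrightarrow> 1 - 1 / real n - sigstar\<^sup>2 / ln (real n) \<le> measure (M n) A)"
        using step[of n] by (metis empty_iff sets.empty_sets)
    qed
    then obtain A where A: "\<And>n. A n \<in> sets (M n)" "\<And>n Y. Y \<in> A n \<Longrightarrow> P n Y"
      "\<And>n. 3 \<le> n \<and> n \<le> d n \<and> 1 / real n < \<delta> \<and> 1 \<le> s n \<and>
        poly_regular \<kappa> n (d n) (X n) (active_set (d n) (bstar n)) (slab n) (bstar n)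
        \<Longrightarrow> 1 - 1 / real n - sigstar\<^sup>2 / ln (real n) \<le> measure (M n) (A n)"
      by metis
    have "(\<lambda>n. measure (M n) (A n)) \<longlonglongrightarrow> 1"
    proof (rule tendsto_sandwich)
      show "\<forall>\<^sub>F n in sequentially. 1 - 1 / real n - sigstar\<^sup>2 / ln (real n) \<le> measure (M n) (A n)"
        using ev by eventually_elim (rule A(3))
      show "\<forall>\<^sub>F n in sequentially. measure (M n) (A n) \<le> 1"
        using prob_space.prob_le_1[OF prob] by simp
      have "(\<lambda>n. sigstar\<^sup>2 / ln (real n)) \<longlonglongrightarrow> 0"
        by (intro tendsto_divide_0[OF tendsto_const] filterlim_at_top_imp_at_infinity
            filterlim_compose[OF ln_at_top filterlim_real_sequentially])
      then have "(\<lambda>n. 1 - 1 / real n - sigstar\<^sup>2 / ln (real n)) \<longlonglongrightarrow> 1 - 0 - 0"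
        by (intro tendsto_intros lim_1_over_n)
      then show "(\<lambda>n. 1 - 1 / real n - sigstar\<^sup>2 / ln (real n)) \<longlonglongrightarrow> 1" by simp
    qed simp
    then have "with_prob_tending_to_one M P"
      unfolding with_prob_tending_to_one_def using A(1,2) by blast
    then show "with_prob_tending_to_one
      (\<lambda>n. data_law (X n) n (d n) (param_of (d n) (bstar n) sigstar))
      (\<lambda>n Y. sqrt (\<integral>\<theta>. avg_hellinger_sq (X n) n (d n) \<theta>
                          (param_of (d n) (bstar n) sigstar) \<partial>qhat n Y)
        \<le> sqrt C * sqrt (real (s n) / (real n * min \<alpha> (1 - \<alpha>)) * ln (real (d n) * real n)))"
      unfolding M_def[abs_def] P_def[abs_def] .
  qed
qed

end
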